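(* Let $\mathcal C_1,\mathcal C_2:\mathbb R^d\to\mathbb R^d$ be a $\delta_1$-approximate and a $\delta_2$-approximate compressor with $\delta_1\in(0,1]$, $\delta_2\in[0,1]$, and let $H>0$ be the (integer) error-reset interval. Assume the smoothness, gradient and global minimum assumptions stated in the context, with constants $L$, $V_1$, $V_1'$, $V_2=V_1+V_1'$ and global minimum $x_*$. Let $(x_{i,t})$ be the iterates of CSER with step size $\eta\le\frac1L$, and let $\bar x_t=\frac1n\sum_{i\in[n]}x_{i,t}$. Then after $T$ iterations $$\frac1T\sum_{t=1}^T\mathbb E\big[\|\nabla F(\bar x_{t-1})\|^2\big]\le \frac{2[F(\bar x_0)-F(x_* )]}{\eta T}+\left[\frac{1-\delta_1}{(1-\sqrt{1-\delta_1})^2}+1\right]2(1-\delta_2)\eta^2L^2H^2V_2+\frac{L\eta V_1}{n}$$ $$\le \frac{2[F(\bar x_0)-F(x_* )]}{\eta T}+\left[\frac{4(1-\delta_1)}{\delta_1^2}+1\right]2(1-\delta_2)\eta^2L^2H^2V_2+\frac{L\eta V_1}{n}.$$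
   Context: Notation: $[n]=\{1,\dots,n\}$, where $n$ is the number of workers; $\|\cdot\|$ is the Euclidean norm on $\mathbb R^d$. Problem: minimize $F(x)=\frac1n\sum_{i\in[n]}F_i(x)$ over $x\in\mathbb R^d$, where $F_i(x)=\mathbb E_{z_i\sim\mathcal D_i}f(x;z_i)$ and $z_i$ is sampled from the local data $\mathcal D_i$ of worker $i$; it is assumed that $\mathcal D_i\ne\mathcal D_j$ for $i\ne j$. $\nabla f(x;z)$ is the gradient in $x$. Compressor: $\mathcal C:\mathbb R^d\to\mathbb R^d$ is a $\delta$-approximate compressor, $\delta\in[0,1]$, if $\|\mathcal C(v)-v\|^2\le(1-\delta)\|v\|^2$ for all $v\in\mathbb R^d$. Partial synchronization: given vectors $v_1,\dots,v_n\in\mathbb R^d$ held by the $n$ workers, $\mathrm{PSync}(v_i,\mathcal C)$ returns to worker $i$ the pair $(v_i',r_i)$ with $r_i=v_i-\mathcal C(v_i)$ and $v_i'=\frac1n\sum_{k\in[n]}\mathcal C(v_k)+r_i$. CSER algorithm (step size $\eta>0$): initialize $x_{i,0}=\hat x_0\in\mathbb R^d$ (the same for all $i$), $e_{i,0}=0$. For $t=1,\dots,T$ and every worker $i\in[n]$: sample $z_{i,t}\sim\mathcal D_i$ and set $g_{i,t}=\nabla f(x_{i,t-1};z_{i,t})$; $(g'_{i,t},r_{i,t})=\mathrm{PSync}(g_{i,t},\mathcal C_2)$; $x_{i,t-\frac12}=x_{i,t-1}-\eta g'_{i,t}$; $e_{i,t-\frac12}=e_{i,t-1}-\eta r_{i,t}$.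 If $H\nmid t$: $x_{i,t}=x_{i,t-\frac12}$, $e_{i,t}=e_{i,t-\frac12}$. If $H\mid t$: $(e'_{i,t-\frac12},e_{i,t})=\mathrm{PSync}(e_{i,t-\frac12},\mathcal C_1)$ and $x_{i,t}=x_{i,t-\frac12}-e_{i,t-\frac12}+e'_{i,t-\frac12}$. Smoothness assumption: each $F_i$, $i\in[n]$, is $L$-smooth, meaning $F_i(y)-F_i(x)\le\langle\nabla F_i(x),y-x\rangle+\frac L2\|y-x\|^2$ for all $x,y$. Gradient assumption: for every stochastic gradient $g_{i,t}=\nabla f(x_{i,t-1};z_{i,t})$, $z_{i,t}\sim\mathcal D_i$, one has $\mathbb E[\|g_{i,t}-\nabla F_i(x_{i,t-1})\|^2]\le V_1$ and $\|\mathbb E[g_{i,t}]\|^2\le V_1'$ for all $i\in[n]$, $t\in[T]$; furthermore, gradients from different workers are independent of each other. (The bound $\mathbb E[\|g_{i,t}\|^2]\le V_2:=V_1+V_1'$ is noted as a consequence.) Global minimum assumption: there exists at least one $x_*$ with $F(x_* )\le F(x)$ for all $x$.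
   Formalization: L-smoothness is taken two-sided (absolute value in the displayed inequality), stochastic gradients are assumed integrable and unbiased for ∇F_i, and ‖E[g_{i,t}]‖² ≤ V_1' is read as the mean given x_{i,t-1}, almost surely; the one-sided or biased version is false. *)

theory Defs
  imports "HOL-Probability.Probability"
begin

text \<open>The gradient as a function; meaningful only at points of differentiability.\<close>

definition gradient :: "('v::real_inner \<Rightarrow> real) \<Rightarrow> 'v \<Rightarrow> 'v" where
  "gradient G x = (THE D. GDERIV G x :> D)"

text \<open>
  The inequality is two-sided, so the gradient is Lipschitz with constant \<open>L\<close>. The upper bound
  alone would allow arbitrarily large negative curvature, in which case the convergence bound
  for CSER fails.
\<close>

definition L_smooth :: "real \<Rightarrow> ('v::real_inner \<Rightarrow> real) \<Rightarrow> bool" where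
  "L_smooth L G \<longleftrightarrow>
     (\<forall>x. G differentiable (at x)) \<and>
     (\<forall>x y. \<bar>G y - G x - gradient G x \<bullet> (y - x)\<bar> \<le> L / 2 * (norm (y - x))\<^sup>2)"

definition approx_compressor :: "real \<Rightarrow> ('v::real_normed_vector \<Rightarrow> 'v) \<Rightarrow> bool" where
  "approx_compressor \<delta> C \<longleftrightarrow>
     0 \<le> \<delta> \<and> \<delta> \<le> 1 \<and> (\<forall>v. (norm (C v - v))\<^sup>2 \<le> (1 - \<delta>) * (norm v)\<^sup>2)"

text \<open>Workers are numbered \<open>1, \<dots>, n\<close>; families of vectors are functions on \<open>nat\<close>, of which only
  the values at these indices matter.\<close>

definition avg :: "nat \<Rightarrow> (nat \<Rightarrow> 'v::real_vector) \<Rightarrow> 'v" where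
  "avg n v = (1 / real n) *\<^sub>R (\<Sum>k = 1..n. v k)"

definition psync :: "nat \<Rightarrow> (nat \<Rightarrow> 'v::real_vector) \<Rightarrow> ('v \<Rightarrow> 'v) \<Rightarrow> nat \<Rightarrow> 'v \<times> 'v" where
  "psync n v C i = (let r = v i - C (v i) in (avg n (\<lambda>k. C (v k)) + r, r))"

definition local_loss :: "('v \<Rightarrow> 'z \<Rightarrow> real) \<Rightarrow> 'z measure \<Rightarrow> 'v \<Rightarrow> real" where
  "local_loss f Di x = (\<integral>z. f x z \<partial>Di)"

definition global_loss :: "nat \<Rightarrow> ('v \<Rightarrow> 'z \<Rightarrow> real) \<Rightarrow> (nat \<Rightarrow> 'z measure) \<Rightarrow> 'v \<Rightarrow> real" where
  "global_loss n f D x = (1 / real n) * (\<Sum>i = 1..n. local_loss f (D i) x)"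

definition stoch_grad :: "('v::real_inner \<Rightarrow> 'z \<Rightarrow> real) \<Rightarrow> 'v \<Rightarrow> 'z \<Rightarrow> 'v" where
  "stoch_grad f x z = gradient (\<lambda>y. f y z) x"

text \<open>The state \<open>(x, e)\<close> after \<open>t\<close> iterations for a fixed realisation \<open>zs i t\<close> of the samples;
  \<open>xh\<close> and \<open>eh\<close> are the half-step quantities.\<close>

primrec cser ::
  "nat \<Rightarrow> nat \<Rightarrow> real \<Rightarrow> ('v::real_inner \<Rightarrow> 'v) \<Rightarrow> ('v \<Rightarrow> 'v) \<Rightarrow> ('v \<Rightarrow> 'z \<Rightarrow> real) \<Rightarrow> 'v \<Rightarrow>
   (nat \<Rightarrow> nat \<Rightarrow> 'z) \<Rightarrow> nat \<Rightarrow> (nat \<Rightarrow> 'v) \<times> (nat \<Rightarrow> 'v)" where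
  "cser n H \<eta> C1 C2 f x0 zs 0 = ((\<lambda>i. x0), (\<lambda>i. 0))"
| "cser n H \<eta> C1 C2 f x0 zs (Suc t) =
     (let (x, e) = cser n H \<eta> C1 C2 f x0 zs t;
          g = (\<lambda>i. stoch_grad f (x i) (zs i (Suc t)));
          xh = (\<lambda>i. x i - \<eta> *\<^sub>R fst (psync n g C2 i));
          eh = (\<lambda>i. e i - \<eta> *\<^sub>R snd (psync n g C2 i))
      in if H dvd Suc t
         then ((\<lambda>i. xh i - eh i + fst (psync n eh C1 i)), (\<lambda>i. snd (psync n eh C1 i)))
         else (xh, eh))"

definition cser_x ::
  "nat \<Rightarrow> nat \<Rightarrow> real \<Rightarrow> ('v::real_inner \<Rightarrow> 'v) \<Rightarrow> ('v \<Rightarrow> 'v) \<Rightarrow> ('v \<Rightarrow> 'z \<Rightarrow> real) \<Rightarrow> 'v \<Rightarrow>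
   (nat \<Rightarrow> nat \<Rightarrow> 'z) \<Rightarrow> nat \<Rightarrow> nat \<Rightarrow> 'v" where
  "cser_x n H \<eta> C1 C2 f x0 zs i t = fst (cser n H \<eta> C1 C2 f x0 zs t) i"

end

theory Submission
  imports Defs
begin

text \<open>
  The difference \<open>x i - e i\<close> is the same for all workers, so \<open>x i - xbar\<close> is the deviation of \<open>e i\<close>
  from its mean, and \<open>xbar\<close> performs exactly averaged SGD with the gradients taken at the \<open>x i\<close>. The
  error \<open>e i\<close> grows by at most \<open>\<eta> * sqrt ((1 - \<delta>2) * V2)\<close> per step in \<open>L\<^sup>2\<close> norm and is contracted by
  \<open>sqrt (1 - \<delta>1)\<close> at each reset, which bounds the consensus error uniformly in time. The gradient
  noises are orthogonal to the past and, across workers, to each other, so the descent lemma along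
  \<open>xbar\<close> telescopes.
\<close>

section \<open>Gradients and smoothness\<close>

text \<open>Averaged SGD with gradients taken at the \<open>x i\<close> is biased as a gradient step
  at \<open>xbar\<close>; smoothness turns this bias into \<open>L\<^sup>2\<close> times the
  consensus error, and only through it do the compressors reach the bound. They are arbitrary maps,
  so their residuals need be neither centred nor orthogonal. Hence the errors are added by Minkowski
  in \<open>L\<^sup>2\<close>: \<open>H\<close> steps cost \<open>H * b\<close>, which after
  squaring is the factor \<open>H\<^sup>2\<close>, and the geometric recursion over resets produces
  \<open>1 - sqrt (1 - \<delta>1)\<close> in the denominator. The obstacle on the noise side is that
  synchronization makes every iterate depend on the samples of all workers, so noises of different
  workers are only conditionally independent. Instead of conditional expectations, iterates are
  written as measurable functions of finite sample histories, and Fubini on product laws gives the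
  orthogonality. The condition \<open>\<eta> \<le> 1 / L\<close> is what removes the squared mean
  step from the descent inequality.\<close>

lemma GDERIV_unique: "GDERIV G x :> D \<Longrightarrow> GDERIV G x :> D' \<Longrightarrow> D = D'"
  unfolding gderiv_def by (drule (1) has_derivative_unique) (metis inner_commute vector_eq_rdot)

lemma gradient_eq: "GDERIV G x :> D \<Longrightarrow> gradient G x = D"
  unfolding gradient_def by (blast intro: GDERIV_unique)

text \<open>Riesz representation in the standard basis: the coordinates of the gradient are the
  derivatives along \<open>Basis\<close>. This makes the definite description in
  \<open>gradient\<close> usable.\<close>

lemma GDERIV_gradient:
  fixes G :: "'a::euclidean_space \<Rightarrow> real"
  assumes "G differentiable at x"
  shows "GDERIV G x :> gradient G x"
proof -
  obtain G' where G': "(G has_derivative G') (at x)"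
    using assms unfolding differentiable_def by blast
  then interpret bounded_linear G' by (rule has_derivative_bounded_linear)
  have "G' h = h \<bullet> (\<Sum>b\<in>Basis. G' b *\<^sub>R b)" for h
  proof -
    have "G' h = G' (\<Sum>b\<in>Basis. (h \<bullet> b) *\<^sub>R b)" by (simp add: euclidean_representation)
    also have "\<dots> = (\<Sum>b\<in>Basis. (h \<bullet> b) * G' b)" by (simp add: sum scaleR)
    finally show ?thesis by (simp add: inner_sum_right mult.commute)
  qed
  with G' have "GDERIV G x :> (\<Sum>b\<in>Basis. G' b *\<^sub>R b)"
    unfolding gderiv_def by (metis (no_types, lifting) ext)
  then show ?thesis using gradient_eq by metis
qed

text \<open>The remainder is quadratic in the increment, hence of smaller order than its norm. A
  gradient can thus be identified from an inequality alone, which is how gradients of averages are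
  found below.\<close>

lemma GDERIV_quadratic_bound:
  fixes G :: "'a::real_inner \<Rightarrow> real"
  assumes "\<And>y. \<bar>G y - G x - D \<bullet> (y - x)\<bar> \<le> K * (norm (y - x))\<^sup>2"
  shows "GDERIV G x :> D"
  unfolding gderiv_def has_derivative_at
proof
  show "bounded_linear (\<lambda>h. h \<bullet> D)" by (rule bounded_linear_inner_left)
  have *: "norm (norm (G (x + h) - G x - h \<bullet> D) / norm h) \<le> \<bar>K\<bar> * norm h" for h
  proof (cases "h = 0")
    case False
    have "\<bar>G (x + h) - G x - h \<bullet> D\<bar> \<le> K * (norm h)\<^sup>2"
      using assms[of "x + h"] by (simp add: inner_commute)
    also have "\<dots> \<le> \<bar>K\<bar> * (norm h)\<^sup>2" by (intro mult_right_mono) auto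
    also have "\<dots> = \<bar>K\<bar> * norm h * norm h" by (simp add: power2_eq_square)
    finally have "\<bar>G (x + h) - G x - h \<bullet> D\<bar> / norm h \<le> \<bar>K\<bar> * norm h"
      using False by (subst pos_divide_le_eq) simp_all
    then show ?thesis by simp
  qed simp
  show "(\<lambda>h. norm (G (x + h) - G x - h \<bullet> D) / norm h) \<midarrow>0\<rightarrow> 0"
    by (rule Lim_null_comparison[OF always_eventually[OF allI[OF *]]])
      (rule tendsto_mult_right_zero[OF tendsto_norm_zero[OF tendsto_ident_at]])
qed

lemma L_smooth_bound:
  "L_smooth L G \<Longrightarrow> \<bar>G y - G x - gradient G x \<bullet> (y - x)\<bar> \<le> L / 2 * (norm (y - x))\<^sup>2"
  by (simp add: L_smooth_def)

text \<open>Testing the two-sided bound at the points \<open>(x + y)/2 \<mp> a/(2L)\<close>, with \<open>a\<close> the difference of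
  the gradients, gives the sharp Lipschitz constant without any convexity.\<close>

lemma L_smooth_gradient_Lipschitz:
  assumes "L_smooth L G" "L > 0"
  shows "norm (gradient G x - gradient G y) \<le> L * norm (x - y)"
proof -
  define a where "a = gradient G x - gradient G y"
  \<comment> \<open>For an offset \<open>s *\<^sub>R a\<close> the argument gives coefficient
    \<open>2 * s - 2 * L * s\<^sup>2\<close> of \<open>(norm a)\<^sup>2\<close>, against
    \<open>L / 2 * (norm (x - y))\<^sup>2\<close>; \<open>s = 1 / (2 * L)\<close> maximises
    it.\<close>
  define p where "p = (1/2) *\<^sub>R (x + y) - (1 / (2 * L)) *\<^sub>R a"
  define q where "q = (1/2) *\<^sub>R (x + y) + (1 / (2 * L)) *\<^sub>R a"
  note b = L_smooth_bound[OF assms(1)]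
  have 1: "G p - G x \<le> gradient G x \<bullet> (p - x) + L / 2 * (norm (p - x))\<^sup>2"
    using b[of p x] unfolding abs_le_iff by linarith
  have 2: "gradient G y \<bullet> (p - y) - L / 2 * (norm (p - y))\<^sup>2 \<le> G p - G y"
    using b[of p y] unfolding abs_le_iff by linarith
  have 3: "G q - G y \<le> gradient G y \<bullet> (q - y) + L / 2 * (norm (q - y))\<^sup>2"
    using b[of q y] unfolding abs_le_iff by linarith
  have 4: "gradient G x \<bullet> (q - x) - L / 2 * (norm (q - x))\<^sup>2 \<le> G q - G x"
    using b[of q x] unfolding abs_le_iff by linarith
  have "gradient G x \<bullet> (p - x) - gradient G x \<bullet> (q - x) + gradient G y \<bullet> (q - y)
      - gradient G y \<bullet> (p - y) = a \<bullet> (p - q)"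
    by (simp add: a_def inner_diff_left inner_diff_right)
  also have "p - q = - (1 / L) *\<^sub>R a"
    unfolding p_def q_def using \<open>L > 0\<close> by (simp add: scaleR_left.add[symmetric] field_simps)
  finally have lin: "gradient G x \<bullet> (p - x) - gradient G x \<bullet> (q - x)
      + gradient G y \<bullet> (q - y) - gradient G y \<bullet> (p - y) = - (1 / L) * (norm a)\<^sup>2"
    by (simp add: power2_norm_eq_inner)
  define u where "u = (1/2) *\<^sub>R (x - y)"
  define w where "w = (1 / (2 * L)) *\<^sub>R a"
  have half: "(1/2) *\<^sub>R v + (1/2) *\<^sub>R v = v" for v :: 'a
    by (simp flip: scaleR_left.add)
  have "x = (1/2) *\<^sub>R (x + y) + u" "y = (1/2) *\<^sub>R (x + y) - u"
    using half[of x] half[of y] by (simp_all add: u_def algebra_simps)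
  then have d: "p - x = - (u + w)" "p - y = u - w" "q - x = - (u - w)" "q - y = u + w"
    unfolding p_def q_def w_def[symmetric] by (simp_all add: algebra_simps)
  have "(norm (p - x))\<^sup>2 + (norm (p - y))\<^sup>2 + (norm (q - x))\<^sup>2 + (norm (q - y))\<^sup>2
     = 4 * (norm u)\<^sup>2 + 4 * (norm w)\<^sup>2"
    unfolding d norm_minus_cancel power2_norm_eq_inner
    by (simp add: inner_add_left inner_add_right inner_diff_left inner_diff_right inner_commute)
  also have "\<dots> = (norm (x - y))\<^sup>2 + (norm a)\<^sup>2 / L\<^sup>2"
    by (simp add: u_def w_def power_mult_distrib power_divide)
  finally have quad: "(norm (p - x))\<^sup>2 + (norm (p - y))\<^sup>2 + (norm (q - x))\<^sup>2 + (norm (q - y))\<^sup>2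
     = (norm (x - y))\<^sup>2 + (norm a)\<^sup>2 / L\<^sup>2" .
  \<comment> \<open>All values of \<open>G\<close> cancel when the lower bounds 2 and 4 are
    subtracted from the upper bounds 1 and 3.\<close>
  have "0 \<le> - (1 / L) * (norm a)\<^sup>2
      + L / 2 * ((norm (p - x))\<^sup>2 + (norm (p - y))\<^sup>2 + (norm (q - x))\<^sup>2 + (norm (q - y))\<^sup>2)"
    using 1 2 3 4 lin by (simp add: algebra_simps)
  then have "(norm a)\<^sup>2 / (2 * L) \<le> L / 2 * (norm (x - y))\<^sup>2"
    unfolding quad using \<open>L > 0\<close> by (simp add: field_simps power2_eq_square)
  then have "(norm a)\<^sup>2 \<le> (L * norm (x - y))\<^sup>2"
    using \<open>L > 0\<close> by (simp add: field_simps power2_eq_square)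
  then show ?thesis unfolding a_def[symmetric]
    by (rule power2_le_imp_le) (use \<open>L > 0\<close> in simp)
qed

section \<open>Averages\<close>

lemma avg_cong: "(\<And>i. i \<in> {1..n} \<Longrightarrow> u i = v i) \<Longrightarrow> avg n u = avg n v"
  unfolding avg_def by (metis (no_types, lifting) sum.cong)

lemma avg_add: "avg n (\<lambda>i. u i + v i) = avg n u + avg n v"
  by (simp add: avg_def sum.distrib scaleR_right_distrib)

lemma avg_diff: "avg n (\<lambda>i. u i - v i) = avg n u - avg n v"
  by (simp add: avg_def sum_subtractf scaleR_right_diff_distrib)

lemma avg_scaleR: "avg n (\<lambda>i. c *\<^sub>R v i) = c *\<^sub>R avg n v"
  by (simp add: avg_def scaleR_sum_right mult.commute)

lemma avg_const: "n \<ge> 1 \<Longrightarrow> avg n (\<lambda>i. c) = c"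
  by (simp add: avg_def sum_constant_scaleR)

lemma sum_avg: "n \<ge> 1 \<Longrightarrow> (\<Sum>i = 1..n. v i) = real n *\<^sub>R avg n v"
  by (simp add: avg_def)

lemma avg_mono:
  fixes u v :: "nat \<Rightarrow> real"
  shows "(\<And>i. i \<in> {1..n} \<Longrightarrow> u i \<le> v i) \<Longrightarrow> avg n u \<le> avg n v"
  unfolding avg_def real_scaleR_def by (intro mult_left_mono sum_mono) auto

text \<open>The variance identity for the uniform distribution on the workers. It yields both
  Jensen's inequality for the squared norm and the consensus bound.\<close>

lemma avg_norm_diff_avg:
  fixes v :: "nat \<Rightarrow> 'a::real_inner"
  assumes "n \<ge> 1"
  shows "avg n (\<lambda>i. (norm (v i - avg n v))\<^sup>2) = avg n (\<lambda>i. (norm (v i))\<^sup>2) - (norm (avg n v))\<^sup>2"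
proof -
  have "(norm (v i - avg n v))\<^sup>2 = (norm (v i))\<^sup>2 + (norm (avg n v))\<^sup>2 - 2 * (avg n v \<bullet> v i)" for i
    by (simp add: power2_norm_eq_inner inner_commute algebra_simps)
  moreover have "(\<Sum>i = 1..n. 2 * (avg n v \<bullet> v i)) = 2 * real n * (norm (avg n v))\<^sup>2"
    using assms by (simp add: sum_distrib_left[symmetric] inner_sum_right[symmetric] sum_avg
        power2_norm_eq_inner del: One_nat_def)
  ultimately show ?thesis
    using assms by (simp add: avg_diff avg_add avg_const avg_scaleR[of n 2, simplified])
      (simp add: avg_def)
qed

lemma norm_avg_squared_le:
  fixes v :: "nat \<Rightarrow> 'a::real_inner"
  assumes "n \<ge> 1"
  shows "(norm (avg n v))\<^sup>2 \<le> avg n (\<lambda>i. (norm (v i))\<^sup>2)"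
proof -
  have "0 \<le> avg n (\<lambda>i. (norm (v i - avg n v))\<^sup>2)"
    unfolding avg_def by (intro scaleR_nonneg_nonneg sum_nonneg) auto
  then show ?thesis using avg_norm_diff_avg[OF assms, of v] by simp
qed

text \<open>Stated with the average of the gradients, because this very bound is what shows that
  average to be the gradient of the averaged function.\<close>

lemma L_smooth_bound_avg:
  fixes G :: "nat \<Rightarrow> 'a::real_inner \<Rightarrow> real"
  assumes "n \<ge> 1" "\<And>i. i \<in> {1..n} \<Longrightarrow> L_smooth L (G i)"
  shows "\<bar>avg n (\<lambda>i. G i y) - avg n (\<lambda>i. G i x) - avg n (\<lambda>i. gradient (G i) x) \<bullet> (y - x)\<bar>
      \<le> L / 2 * (norm (y - x))\<^sup>2"
proof -
  have "avg n (\<lambda>i. G i y) - avg n (\<lambda>i. G i x) - avg n (\<lambda>i. gradient (G i) x) \<bullet> (y - x)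
      = avg n (\<lambda>i. G i y - G i x - gradient (G i) x \<bullet> (y - x))"
    by (simp add: avg_diff) (simp add: avg_def inner_sum_left)
  also have "\<bar>\<dots>\<bar> \<le> avg n (\<lambda>i. \<bar>G i y - G i x - gradient (G i) x \<bullet> (y - x)\<bar>)"
    by (simp add: avg_def abs_mult divide_right_mono)
  also have "\<dots> \<le> avg n (\<lambda>i. L / 2 * (norm (y - x))\<^sup>2)"
    by (intro avg_mono L_smooth_bound assms)
  also have "\<dots> = L / 2 * (norm (y - x))\<^sup>2"
    using assms(1) by (rule avg_const)
  finally show ?thesis .
qed

lemma gradient_avg:
  fixes G :: "nat \<Rightarrow> 'a::real_inner \<Rightarrow> real"
  assumes "n \<ge> 1" "\<And>i. i \<in> {1..n} \<Longrightarrow> L_smooth L (G i)"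
  shows "gradient (\<lambda>y. avg n (\<lambda>i. G i y)) x = avg n (\<lambda>i. gradient (G i) x)"
  using assms by (intro gradient_eq GDERIV_quadratic_bound[where K = "L / 2"] L_smooth_bound_avg)

lemma L_smooth_avg:
  fixes G :: "nat \<Rightarrow> 'a::real_inner \<Rightarrow> real"
  assumes "n \<ge> 1" "\<And>i. i \<in> {1..n} \<Longrightarrow> L_smooth L (G i)"
  shows "L_smooth L (\<lambda>y. avg n (\<lambda>i. G i y))"
proof -
  have *: "GDERIV (\<lambda>y. avg n (\<lambda>i. G i y)) x :> avg n (\<lambda>i. gradient (G i) x)" for x
    using assms by (intro GDERIV_quadratic_bound[where K = "L / 2"] L_smooth_bound_avg)
  then have "(\<lambda>y. avg n (\<lambda>i. G i y)) differentiable at x" for x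
    unfolding gderiv_def differentiable_def by blast
  then show ?thesis
    unfolding L_smooth_def gradient_eq[OF *] using L_smooth_bound_avg[where G = G, OF assms] by blast
qed

section \<open>The CSER recursion\<close>

lemma approx_compressor_residual:
  "approx_compressor \<delta> C \<Longrightarrow> (norm (v - C v))\<^sup>2 \<le> (1 - \<delta>) * (norm v)\<^sup>2"
  by (simp add: approx_compressor_def norm_minus_commute)

text \<open>The local residual enters \<open>x\<close> and \<open>e\<close> with the same sign and
  factor, so it cancels in the difference; what remains are averages shared by all workers. The same
  cancellation happens at a reset.\<close>

lemma cser_x_minus_error:
  "fst (cser n H \<eta> C1 C2 f x0 zs t) i - snd (cser n H \<eta> C1 C2 f x0 zs t) i
   = fst (cser n H \<eta> C1 C2 f x0 zs t) j - snd (cser n H \<eta> C1 C2 f x0 zs t) j"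
proof (induction t)
  case (Suc t)
  have *: "u - \<eta> *\<^sub>R (m + r) - (v - \<eta> *\<^sub>R r) = u - v - \<eta> *\<^sub>R m" for u v m r :: 'a
    by (simp add: algebra_simps)
  show ?case
    using Suc by (simp add: * psync_def Let_def case_prod_beta)
qed simp

lemma cser_error_Suc:
  fixes f n H \<eta> C1 C2 x0 zs t i
  defines "g \<equiv> stoch_grad f (fst (cser n H \<eta> C1 C2 f x0 zs t) i) (zs i (Suc t))"
  defines "e \<equiv> snd (cser n H \<eta> C1 C2 f x0 zs t) i - \<eta> *\<^sub>R (g - C2 g)"
  shows "snd (cser n H \<eta> C1 C2 f x0 zs (Suc t)) i = (if H dvd Suc t then e - C1 e else e)"
  unfolding e_def g_def by (simp add: psync_def Let_def case_prod_beta)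

text \<open>Partial synchronization preserves the average: the shared compressed mean plus the mean
  residual is the mean of the inputs. So \<open>C2\<close> drops out of the averaged step, and a
  reset with \<open>C1\<close> does not move the average.\<close>

lemma avg_cser_Suc:
  assumes "n \<ge> 1"
  shows "avg n (fst (cser n H \<eta> C1 C2 f x0 zs (Suc t))) = avg n (fst (cser n H \<eta> C1 C2 f x0 zs t))
     - \<eta> *\<^sub>R avg n (\<lambda>i. stoch_grad f (fst (cser n H \<eta> C1 C2 f x0 zs t) i) (zs i (Suc t)))"
  using assms
  by (simp add: psync_def Let_def case_prod_beta avg_add avg_diff avg_scaleR avg_const)

text \<open>Adaptedness: this allows the samples to be replaced by their restriction to any index
  set that contains the past.\<close>

lemma cser_cong:
  assumes "\<And>j s. j \<in> {1..n} \<Longrightarrow> s \<in> {1..t} \<Longrightarrow> zs j s = zs' j s" "i \<in> {1..n}"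
  shows "fst (cser n H \<eta> C1 C2 f x0 zs t) i = fst (cser n H \<eta> C1 C2 f x0 zs' t) i
       \<and> snd (cser n H \<eta> C1 C2 f x0 zs t) i = snd (cser n H \<eta> C1 C2 f x0 zs' t) i"
  using assms
proof (induction t arbitrary: i)
  case (Suc t)
  have IH: "fst (cser n H \<eta> C1 C2 f x0 zs t) k = fst (cser n H \<eta> C1 C2 f x0 zs' t) k"
      "snd (cser n H \<eta> C1 C2 f x0 zs t) k = snd (cser n H \<eta> C1 C2 f x0 zs' t) k"
      "zs k (Suc t) = zs' k (Suc t)" if "k \<in> {1..n}" for k
    using Suc.IH[of k] Suc.prems that by auto
  show ?case
    using Suc.prems(2)
    by (simp add: psync_def Let_def case_prod_beta IH cong: avg_cong del: One_nat_def atLeastAtMost_iff)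
qed simp

text \<open>The common shift \<open>y\<close> drops out of the deviations, and removing a mean
  cannot increase the mean square; the squared norm of the mean error is discarded.\<close>

lemma avg_norm_x_minus_avg_le:
  fixes n H \<eta> C1 C2 f x0 zs t
  defines "c \<equiv> cser n H \<eta> C1 C2 f x0 zs t"
  assumes "n \<ge> 1"
  shows "avg n (\<lambda>i. (norm (avg n (fst c) - fst c i))\<^sup>2) \<le> avg n (\<lambda>i. (norm (snd c i))\<^sup>2)"
proof -
  define y where "y = fst c 1 - snd c 1"
  have x: "fst c i = snd c i + y" for i
    using cser_x_minus_error[of n H \<eta> C1 C2 f x0 zs t i 1] by (simp add: c_def y_def algebra_simps)
  have "avg n (fst c) = avg n (\<lambda>i. snd c i + y)" using x by (simp add: avg_def)
  then have "avg n (fst c) = avg n (snd c) + y" by (simp add: avg_add avg_const[OF assms(2)])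
  then have "(norm (avg n (fst c) - fst c i))\<^sup>2 = (norm (snd c i - avg n (snd c)))\<^sup>2" for i
    by (simp add: x norm_minus_commute)
  then show ?thesis by (simp add: avg_norm_diff_avg[OF assms(2)])
qed

section \<open>Measurability\<close>

lemma borel_measurable_avg [measurable (raw)]:
  fixes v :: "'w \<Rightarrow> nat \<Rightarrow> 'a::euclidean_space"
  assumes "\<And>i. i \<in> {1..n} \<Longrightarrow> (\<lambda>\<omega>. v \<omega> i) \<in> borel_measurable M"
  shows "(\<lambda>\<omega>. avg n (v \<omega>)) \<in> borel_measurable M"
  unfolding avg_def using assms by measurable

text \<open>Only \<open>f\<close> is assumed measurable. Each coordinate of its gradient is the
  limit of difference quotients along the countable sequence \<open>1 / (k + 1)\<close>, and these
  are measurable.\<close>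

lemma borel_measurable_stoch_grad:
  fixes f :: "'a::euclidean_space \<Rightarrow> 'z \<Rightarrow> real"
  assumes f: "(\<lambda>(y, \<zeta>). f y \<zeta>) \<in> borel_measurable (borel \<Otimes>\<^sub>M Z)"
    and diff: "\<And>y \<zeta>. \<zeta> \<in> space Z \<Longrightarrow> (\<lambda>y'. f y' \<zeta>) differentiable (at y)"
  shows "(\<lambda>(y, \<zeta>). stoch_grad f y \<zeta>) \<in> borel_measurable (borel \<Otimes>\<^sub>M Z)"
proof -
  let ?t = "\<lambda>k. inverse (real (Suc k))"
  let ?u = "\<lambda>b k p. (f (fst p + ?t k *\<^sub>R b) (snd p) - f (fst p) (snd p)) / ?t k"
  have "(\<lambda>p. stoch_grad f (fst p) (snd p) \<bullet> b) \<in> borel_measurable (borel \<Otimes>\<^sub>M Z)" for b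
  proof (rule borel_measurable_LIMSEQ_real)
    fix k
    have "(\<lambda>p. f (fst p + c) (snd p)) \<in> borel_measurable (borel \<Otimes>\<^sub>M Z)" for c
      using measurable_compose[OF _ f, of "\<lambda>p. (fst p + c, snd p)"] by simp
    from this[of "?t k *\<^sub>R b"] this[of 0]
    show "?u b k \<in> borel_measurable (borel \<Otimes>\<^sub>M Z)"
      by (intro borel_measurable_divide borel_measurable_diff) simp_all
  next
    fix p :: "'a \<times> 'z" assume "p \<in> space (borel \<Otimes>\<^sub>M Z)"
    then have "snd p \<in> space Z" by (auto simp: space_pair_measure)
    then have "((\<lambda>y. f y (snd p)) has_derivative (\<lambda>h. h \<bullet> stoch_grad f (fst p) (snd p)))
        (at (fst p + 0 *\<^sub>R b))"
      using GDERIV_gradient[OF diff] by (simp add: gderiv_def stoch_grad_def)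
    moreover have "((\<lambda>t. fst p + t *\<^sub>R b) has_derivative (\<lambda>t. t *\<^sub>R b)) (at 0)"
      by (auto intro!: derivative_eq_intros)
    ultimately have "((\<lambda>t. f (fst p + t *\<^sub>R b) (snd p)) has_derivative
        (\<lambda>t. (t *\<^sub>R b) \<bullet> stoch_grad f (fst p) (snd p))) (at 0)"
      by (rule has_derivative_compose[rotated])
    then have "((\<lambda>t. f (fst p + t *\<^sub>R b) (snd p)) has_real_derivative
        (stoch_grad f (fst p) (snd p) \<bullet> b)) (at 0)"
      by (rule has_derivative_imp_has_field_derivative) (simp add: inner_commute)
    then have "((\<lambda>t. (f (fst p + t *\<^sub>R b) (snd p) - f (fst p) (snd p)) / t) \<longlongrightarrow>
        stoch_grad f (fst p) (snd p) \<bullet> b) (at 0)"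
      by (simp add: DERIV_def)
    moreover have "filterlim ?t (at 0) sequentially"
      by (intro filterlim_atI LIMSEQ_inverse_real_of_nat) auto
    ultimately show "(\<lambda>k. ?u b k p) \<longlonglongrightarrow> stoch_grad f (fst p) (snd p) \<bullet> b"
      by (rule filterlim_compose)
  qed
  then show ?thesis
    by (subst borel_measurable_euclidean_space) (simp add: case_prod_beta')
qed

text \<open>Pairs index the samples so that they form a single product space. \<open>A\<close> may
  exceed the past: orthogonality between workers also needs the simultaneous samples of the
  others.\<close>

lemma measurable_cser:
  fixes f :: "'a::euclidean_space \<Rightarrow> 'z \<Rightarrow> real"
  assumes C [measurable]: "C1 \<in> borel_measurable borel" "C2 \<in> borel_measurable borel"
    and g: "(\<lambda>(y, \<zeta>). stoch_grad f y \<zeta>) \<in> borel_measurable (borel \<Otimes>\<^sub>M Z)"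
    and A: "{1..n} \<times> {1..t} \<subseteq> A" and "i \<in> {1..n}"
  shows "(\<lambda>h. fst (cser n H \<eta> C1 C2 f x0 (\<lambda>j s. h (j, s)) t) i)
        \<in> borel_measurable (Pi\<^sub>M A (\<lambda>_. Z))"
    and "(\<lambda>h. snd (cser n H \<eta> C1 C2 f x0 (\<lambda>j s. h (j, s)) t) i)
        \<in> borel_measurable (Pi\<^sub>M A (\<lambda>_. Z))"
proof -
  have "(\<lambda>h. fst (cser n H \<eta> C1 C2 f x0 (\<lambda>j s. h (j, s)) t) i)
        \<in> borel_measurable (Pi\<^sub>M A (\<lambda>_. Z)) \<and>
      (\<lambda>h. snd (cser n H \<eta> C1 C2 f x0 (\<lambda>j s. h (j, s)) t) i)
        \<in> borel_measurable (Pi\<^sub>M A (\<lambda>_. Z))"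
    using A \<open>i \<in> {1..n}\<close>
  proof (induction t arbitrary: i)
    case (Suc t)
    let ?x = "\<lambda>k h. fst (cser n H \<eta> C1 C2 f x0 (\<lambda>j s. h (j, s)) t) k"
    let ?e = "\<lambda>k h. snd (cser n H \<eta> C1 C2 f x0 (\<lambda>j s. h (j, s)) t) k"
    have sub: "{1..n} \<times> {1..t} \<subseteq> A" using Suc.prems by auto
    have x: "?x k \<in> borel_measurable (Pi\<^sub>M A (\<lambda>_. Z))"
      and e: "?e k \<in> borel_measurable (Pi\<^sub>M A (\<lambda>_. Z))" if "k \<in> {1..n}" for k
      using Suc.IH[OF sub that] by auto
    have g': "(\<lambda>h. stoch_grad f (?x k h) (h (k, Suc t))) \<in> borel_measurable (Pi\<^sub>M A (\<lambda>_. Z))"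
      if "k \<in> {1..n}" for k
    proof -
      have "(\<lambda>h. h (k, Suc t)) \<in> measurable (Pi\<^sub>M A (\<lambda>_. Z)) Z"
        using Suc.prems that by (intro measurable_component_singleton) auto
      then have "(\<lambda>h. (?x k h, h (k, Suc t))) \<in> measurable (Pi\<^sub>M A (\<lambda>_. Z)) (borel \<Otimes>\<^sub>M Z)"
        using x[OF that] by measurable
      from measurable_compose[OF this g] show ?thesis by simp
    qed
    note [measurable] = x e g' x[OF Suc.prems(2)] e[OF Suc.prems(2)] g'[OF Suc.prems(2)]
    show ?case
      unfolding cser.simps psync_def Let_def case_prod_beta
      by (cases "H dvd Suc t") (simp_all only: if_True if_False fst_conv snd_conv, measurable)
  qed simp
  then show "(\<lambda>h. fst (cser n H \<eta> C1 C2 f x0 (\<lambda>j s. h (j, s)) t) i)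
        \<in> borel_measurable (Pi\<^sub>M A (\<lambda>_. Z))"
    and "(\<lambda>h. snd (cser n H \<eta> C1 C2 f x0 (\<lambda>j s. h (j, s)) t) i)
        \<in> borel_measurable (Pi\<^sub>M A (\<lambda>_. Z))"
    by auto
qed

section \<open>Square-integrable random vectors\<close>

definition sq_integrable :: "'w measure \<Rightarrow> ('w \<Rightarrow> 'a::euclidean_space) \<Rightarrow> bool" where
  "sq_integrable M X \<longleftrightarrow> X \<in> borel_measurable M \<and> integrable M (\<lambda>\<omega>. (norm (X \<omega>))\<^sup>2)"

lemma sq_integrableD:
  assumes "sq_integrable M X"
  shows "X \<in> borel_measurable M" "integrable M (\<lambda>\<omega>. (norm (X \<omega>))\<^sup>2)"
  using assms by (auto simp: sq_integrable_def)

lemma sq_integrable_bound: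
  assumes "sq_integrable M X" "Y \<in> borel_measurable M"
    and "\<And>\<omega>. (norm (Y \<omega>))\<^sup>2 \<le> c * (norm (X \<omega>))\<^sup>2"
  shows "sq_integrable M Y"
  unfolding sq_integrable_def
proof (intro conjI assms(2) Bochner_Integration.integrable_bound[OF
      integrable_mult_right[where c = c, OF sq_integrableD(2)[OF assms(1)]]] AE_I2)
  show "(\<lambda>\<omega>. (norm (Y \<omega>))\<^sup>2) \<in> borel_measurable M" using assms(2) by measurable
  show "norm ((norm (Y \<omega>))\<^sup>2) \<le> norm (c * (norm (X \<omega>))\<^sup>2)" for \<omega>
    unfolding real_norm_def abs_power2 by (rule order_trans[OF assms(3) abs_ge_self])
qed

lemma sq_integrable_scaleR:
  assumes "sq_integrable M X"
  shows "sq_integrable M (\<lambda>\<omega>. c *\<^sub>R X \<omega>)"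
proof (rule sq_integrable_bound[OF assms, where c = "c\<^sup>2"])
  show "(\<lambda>\<omega>. c *\<^sub>R X \<omega>) \<in> borel_measurable M"
    using sq_integrableD(1)[OF assms] by measurable
qed (simp add: power_mult_distrib)

lemma sq_integrable_add:
  assumes "sq_integrable M X" "sq_integrable M Y"
  shows "sq_integrable M (\<lambda>\<omega>. X \<omega> + Y \<omega>)"
  unfolding sq_integrable_def
proof
  note [measurable] = sq_integrableD(1)[OF assms(1)] sq_integrableD(1)[OF assms(2)]
  show "(\<lambda>\<omega>. X \<omega> + Y \<omega>) \<in> borel_measurable M" by measurable
  have "integrable M (\<lambda>\<omega>. 2 * (norm (X \<omega>))\<^sup>2 + 2 * (norm (Y \<omega>))\<^sup>2)"
    using assms by (simp add: sq_integrable_def)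
  then show "integrable M (\<lambda>\<omega>. (norm (X \<omega> + Y \<omega>))\<^sup>2)"
  proof (rule Bochner_Integration.integrable_bound)
    show "AE \<omega> in M. norm ((norm (X \<omega> + Y \<omega>))\<^sup>2) \<le> norm (2 * (norm (X \<omega>))\<^sup>2 + 2 * (norm (Y \<omega>))\<^sup>2)"
    proof (intro AE_I2)
      fix \<omega>
      have "(norm (X \<omega> + Y \<omega>))\<^sup>2 + (norm (X \<omega> - Y \<omega>))\<^sup>2 = 2 * (norm (X \<omega>))\<^sup>2 + 2 * (norm (Y \<omega>))\<^sup>2"
        by (simp add: power2_norm_eq_inner inner_add_left inner_add_right inner_diff_left
            inner_diff_right)
      then show "norm ((norm (X \<omega> + Y \<omega>))\<^sup>2) \<le> norm (2 * (norm (X \<omega>))\<^sup>2 + 2 * (norm (Y \<omega>))\<^sup>2)"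
        using zero_le_power2[of "norm (X \<omega> - Y \<omega>)"] by (simp only: real_norm_def abs_power2)
    qed
  qed measurable
qed

lemma sq_integrable_diff:
  assumes "sq_integrable M X" "sq_integrable M Y"
  shows "sq_integrable M (\<lambda>\<omega>. X \<omega> - Y \<omega>)"
  using sq_integrable_add[OF assms(1) sq_integrable_scaleR[OF assms(2), of "-1"]] by simp

lemma sq_integrable_sum:
  assumes "\<And>i. i \<in> I \<Longrightarrow> sq_integrable M (X i)"
  shows "sq_integrable M (\<lambda>\<omega>. \<Sum>i\<in>I. X i \<omega>)"
  using assms
  by (induction I rule: infinite_finite_induct)
    (simp_all add: sq_integrable_add, simp_all add: sq_integrable_def)

lemma sq_integrable_avg:
  assumes "\<And>i. i \<in> {1..n} \<Longrightarrow> sq_integrable M (X i)"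
  shows "sq_integrable M (\<lambda>\<omega>. avg n (\<lambda>i. X i \<omega>))"
  unfolding avg_def by (intro sq_integrable_scaleR sq_integrable_sum assms)

lemma sq_integrable_const: "finite_measure M \<Longrightarrow> sq_integrable M (\<lambda>\<omega>. c)"
  by (simp add: sq_integrable_def finite_measure.integrable_const)

lemma integrable_inner_sq_integrable:
  assumes "sq_integrable M X" "sq_integrable M Y"
  shows "integrable M (\<lambda>\<omega>. X \<omega> \<bullet> Y \<omega>)"
proof -
  have "integrable M (\<lambda>\<omega>. ((norm (X \<omega> + Y \<omega>))\<^sup>2 - (norm (X \<omega>))\<^sup>2 - (norm (Y \<omega>))\<^sup>2) / 2)"
    using sq_integrable_add[OF assms] assms by (simp add: sq_integrable_def)
  then show ?thesis by (simp flip: dot_norm)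
qed

lemma integral_norm_add_squared:
  assumes "sq_integrable M X" "sq_integrable M Y"
  shows "(\<integral>\<omega>. (norm (X \<omega> + Y \<omega>))\<^sup>2 \<partial>M)
    = (\<integral>\<omega>. (norm (X \<omega>))\<^sup>2 \<partial>M) + 2 * (\<integral>\<omega>. X \<omega> \<bullet> Y \<omega> \<partial>M) + (\<integral>\<omega>. (norm (Y \<omega>))\<^sup>2 \<partial>M)"
proof -
  have "(norm (X \<omega> + Y \<omega>))\<^sup>2 = (norm (X \<omega>))\<^sup>2 + 2 * (X \<omega> \<bullet> Y \<omega>) + (norm (Y \<omega>))\<^sup>2" for \<omega>
    by (simp add: power2_norm_eq_inner inner_add_left inner_add_right inner_commute)
  then show ?thesis
    using sq_integrableD(2)[OF assms(1)] sq_integrableD(2)[OF assms(2)]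
      integrable_inner_sq_integrable[OF assms] by simp
qed

text \<open>Majorants \<open>a\<close>, \<open>b\<close> of the norms suffice for error recursions.
  The expanded square of \<open>d *\<^sub>R X - c *\<^sub>R Y\<close> has to be divided by
  \<open>c * d\<close>, so the inequality is proved for positive \<open>c\<close>, \<open>d\<close>
  above the majorants; a zero majorant is reached in the limit.\<close>

lemma L2_Cauchy_Schwarz:
  assumes X: "sq_integrable M X" "(\<integral>\<omega>. (norm (X \<omega>))\<^sup>2 \<partial>M) \<le> a\<^sup>2" "0 \<le> a"
    and Y: "sq_integrable M Y" "(\<integral>\<omega>. (norm (Y \<omega>))\<^sup>2 \<partial>M) \<le> b\<^sup>2" "0 \<le> b"
  shows "(\<integral>\<omega>. X \<omega> \<bullet> Y \<omega> \<partial>M) \<le> a * b"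
proof -
  let ?I = "\<integral>\<omega>. X \<omega> \<bullet> Y \<omega> \<partial>M"
  have le: "?I \<le> c * d" if "a \<le> c" "b \<le> d" "0 < c" "0 < d" for c d
  proof -
    have "0 \<le> (\<integral>\<omega>. (norm (d *\<^sub>R X \<omega> + (- c) *\<^sub>R Y \<omega>))\<^sup>2 \<partial>M)" by simp
    also have "\<dots> = d\<^sup>2 * (\<integral>\<omega>. (norm (X \<omega>))\<^sup>2 \<partial>M) - 2 * (c * d) * ?I
        + c\<^sup>2 * (\<integral>\<omega>. (norm (Y \<omega>))\<^sup>2 \<partial>M)"
      unfolding integral_norm_add_squared[OF sq_integrable_scaleR[OF X(1)]
          sq_integrable_scaleR[OF Y(1)]]
      by (simp add: power_mult_distrib)
    also have "\<dots> \<le> d\<^sup>2 * c\<^sup>2 - 2 * (c * d) * ?I + c\<^sup>2 * d\<^sup>2"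
    proof (intro add_mono diff_mono mult_left_mono order_refl)
      show "(\<integral>\<omega>. (norm (X \<omega>))\<^sup>2 \<partial>M) \<le> c\<^sup>2"
        using X(2) power_mono[OF that(1) X(3), of 2] by linarith
      show "(\<integral>\<omega>. (norm (Y \<omega>))\<^sup>2 \<partial>M) \<le> d\<^sup>2"
        using Y(2) power_mono[OF that(2) Y(3), of 2] by linarith
    qed (use that in auto)
    finally have "(c * d) * ?I \<le> (c * d) * (c * d)" by (simp add: power2_eq_square algebra_simps)
    then show ?thesis using that by (subst (asm) mult_le_cancel_left_pos) auto
  qed
  have "((\<lambda>\<epsilon>. (a + \<epsilon>) * (b + \<epsilon>)) \<longlongrightarrow> (a + 0) * (b + 0)) (at_right 0)"
    by (intro tendsto_intros)
  moreover have "\<forall>\<^sub>F \<epsilon> in at_right 0. ?I \<le> (a + \<epsilon>) * (b + \<epsilon>)"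
    by (rule eventually_mono[OF eventually_at_right_less]) (use X Y in \<open>auto intro!: le\<close>)
  ultimately have "?I \<le> (a + 0) * (b + 0)"
    by (rule tendsto_lowerbound) simp
  then show ?thesis by simp
qed

lemma L2_Minkowski:
  assumes "sq_integrable M X" "(\<integral>\<omega>. (norm (X \<omega>))\<^sup>2 \<partial>M) \<le> a\<^sup>2" "0 \<le> a"
    and "sq_integrable M Y" "(\<integral>\<omega>. (norm (Y \<omega>))\<^sup>2 \<partial>M) \<le> b\<^sup>2" "0 \<le> b"
  shows "(\<integral>\<omega>. (norm (X \<omega> + Y \<omega>))\<^sup>2 \<partial>M) \<le> (a + b)\<^sup>2"
  using integral_norm_add_squared[OF assms(1,4)] L2_Cauchy_Schwarz[OF assms] assms(2,5)
  by (simp add: power2_sum)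

text \<open>Stands in for conditioning on \<open>U\<close>: independence makes the joint law a
  product, and Fubini, for which integrability of \<open>h\<close> is required, reduces the claim to
  the vanishing inner integrals.\<close>

lemma (in prob_space) expectation_indep_eq_0:
  fixes h :: "'b \<times> 'b \<Rightarrow> real"
  assumes indep: "indep_var N U P W"
    and h: "h \<in> borel_measurable (N \<Otimes>\<^sub>M P)" "integrable M (\<lambda>\<omega>. h (U \<omega>, W \<omega>))"
    and 0: "\<And>u. u \<in> space N \<Longrightarrow> (\<integral>w. h (u, w) \<partial>distr M P W) = 0"
  shows "expectation (\<lambda>\<omega>. h (U \<omega>, W \<omega>)) = 0"
proof -
  note [measurable] = indep_var_rv1[OF indep] indep_var_rv2[OF indep]
  interpret U: prob_space "distr M N U" by (rule prob_space_distr) measurable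
  interpret W: prob_space "distr M P W" by (rule prob_space_distr) measurable
  interpret UW: pair_prob_space "distr M N U" "distr M P W" ..
  have eq: "distr M (N \<Otimes>\<^sub>M P) (\<lambda>\<omega>. (U \<omega>, W \<omega>)) = distr M N U \<Otimes>\<^sub>M distr M P W"
    using indep by (simp add: indep_var_distribution_eq)
  have int: "integrable (distr M N U \<Otimes>\<^sub>M distr M P W) h"
    unfolding eq[symmetric] using h by (subst integrable_distr_eq) auto
  have "expectation (\<lambda>\<omega>. h (U \<omega>, W \<omega>)) = integral\<^sup>L (distr M N U \<Otimes>\<^sub>M distr M P W) h"
    unfolding eq[symmetric] using h by (subst integral_distr) auto
  also have "\<dots> = (\<integral>u. (\<integral>w. h (u, w) \<partial>distr M P W) \<partial>distr M N U)"
    using UW.integral_fst'[OF int] by simp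
  also have "\<dots> = (\<integral>u. 0 \<partial>distr M N U)"
    by (intro Bochner_Integration.integral_cong refl 0) simp
  finally show ?thesis by simp
qed

section \<open>The CSER process\<close>

locale cser_process = prob_space M for M :: "'w measure" +
  fixes n H T :: nat
    and f :: "'v::euclidean_space \<Rightarrow> 'z \<Rightarrow> real"
    and Z :: "'z measure" and D :: "nat \<Rightarrow> 'z measure"
    and z :: "nat \<Rightarrow> nat \<Rightarrow> 'w \<Rightarrow> 'z"
    and C1 C2 :: "'v \<Rightarrow> 'v" and x0 :: 'v
    and \<eta> L \<delta>1 \<delta>2 :: real
  assumes n: "n \<ge> 1" and T: "T \<ge> 1" and H: "H > 0"
    and C1: "approx_compressor \<delta>1 C1" "0 < \<delta>1" "C1 \<in> borel_measurable borel"
    and C2: "approx_compressor \<delta>2 C2" "C2 \<in> borel_measurable borel"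
    and f_measurable: "(\<lambda>(y, \<zeta>). f y \<zeta>) \<in> borel_measurable (borel \<Otimes>\<^sub>M Z)"
    and f_differentiable: "\<And>y \<zeta>. \<zeta> \<in> space Z \<Longrightarrow> (\<lambda>y'. f y' \<zeta>) differentiable (at y)"
    and sg_integrable: "\<And>i y. i \<in> {1..n} \<Longrightarrow> integrable (D i) (stoch_grad f y)"
    and sg_unbiased: "\<And>i y. i \<in> {1..n} \<Longrightarrow>
      (\<integral>\<zeta>. stoch_grad f y \<zeta> \<partial>D i) = gradient (local_loss f (D i)) y"
    and z_indep: "indep_vars (\<lambda>_. Z) (\<lambda>(i, t). z i t) ({1..n} \<times> {1..T})"
    and z_distr: "\<And>i t. i \<in> {1..n} \<Longrightarrow> t \<in> {1..T} \<Longrightarrow> distr M Z (z i t) = D i"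
    and \<eta>: "0 < \<eta>" "\<eta> \<le> 1 / L"
    and smooth: "\<And>i. i \<in> {1..n} \<Longrightarrow> L_smooth L (local_loss f (D i))"
begin

definition x :: "nat \<Rightarrow> nat \<Rightarrow> 'w \<Rightarrow> 'v" where
  "x i t \<omega> = fst (cser n H \<eta> C1 C2 f x0 (\<lambda>j s. z j s \<omega>) t) i"

definition e :: "nat \<Rightarrow> nat \<Rightarrow> 'w \<Rightarrow> 'v" where
  "e i t \<omega> = snd (cser n H \<eta> C1 C2 f x0 (\<lambda>j s. z j s \<omega>) t) i"

definition xbar :: "nat \<Rightarrow> 'w \<Rightarrow> 'v" where
  "xbar t \<omega> = avg n (\<lambda>i. x i t \<omega>)"

definition grad_F :: "'v \<Rightarrow> 'v" where
  "grad_F y = avg n (\<lambda>i. gradient (local_loss f (D i)) y)"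

text \<open>Time is shifted: \<open>sg i t\<close>, \<open>mean i t\<close> and \<open>noise i t\<close> belong to iteration \<open>t + 1\<close>, which
  starts from \<open>x i t\<close>.\<close>

definition sg :: "nat \<Rightarrow> nat \<Rightarrow> 'w \<Rightarrow> 'v" where
  "sg i t \<omega> = stoch_grad f (x i t \<omega>) (z i (Suc t) \<omega>)"

definition mean :: "nat \<Rightarrow> nat \<Rightarrow> 'w \<Rightarrow> 'v" where
  "mean i t \<omega> = gradient (local_loss f (D i)) (x i t \<omega>)"

definition noise :: "nat \<Rightarrow> nat \<Rightarrow> 'w \<Rightarrow> 'v" where
  "noise i t \<omega> = sg i t \<omega> - mean i t \<omega>"

text \<open>The restriction makes each value a point of the product space over \<open>A\<close>, the
  form in which independence over disjoint index sets is available.\<close>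

definition history :: "(nat \<times> nat) set \<Rightarrow> 'w \<Rightarrow> nat \<times> nat \<Rightarrow> 'z" where
  "history A \<omega> = restrict (\<lambda>p. case p of (i, t) \<Rightarrow> z i t \<omega>) A"

text \<open>Follows from \<open>0 < \<eta> \<le> 1 / L\<close>; the case \<open>L = 0\<close> is
  excluded because \<open>1 / 0 = 0\<close>.\<close>

lemma L_pos: "L > 0"
  using \<eta> by (metis divide_le_0_1_iff linorder_not_less order.strict_trans1)

lemma z_measurable: "i \<in> {1..n} \<Longrightarrow> t \<in> {1..T} \<Longrightarrow> z i t \<in> measurable M Z"
  using z_indep unfolding indep_vars_def by auto

lemma history_measurable:
  assumes "A \<subseteq> {1..n} \<times> {1..T}"
  shows "history A \<in> measurable M (Pi\<^sub>M A (\<lambda>_. Z))"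
  unfolding history_def using assms by (intro measurable_restrict) (auto intro!: z_measurable)

lemma stoch_grad_measurable: "(\<lambda>(y, \<zeta>). stoch_grad f y \<zeta>) \<in> borel_measurable (borel \<Otimes>\<^sub>M Z)"
  using f_measurable f_differentiable by (rule borel_measurable_stoch_grad)

lemma gradient_loss_measurable:
  assumes "i \<in> {1..n}"
  shows "gradient (local_loss f (D i)) \<in> borel_measurable borel"
proof (intro borel_measurable_continuous_onI)
  have "L-lipschitz_on UNIV (gradient (local_loss f (D i)))"
    using L_smooth_gradient_Lipschitz[OF smooth[OF assms] L_pos] L_pos
    by (intro lipschitz_onI) (auto simp: dist_norm)
  then show "continuous_on UNIV (gradient (local_loss f (D i)))"
    by (rule lipschitz_on_continuous_on)
qed

lemma state_history:
  assumes "{1..n} \<times> {1..t} \<subseteq> A" "i \<in> {1..n}"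
  shows "x i t \<omega> = fst (cser n H \<eta> C1 C2 f x0 (\<lambda>j s. history A \<omega> (j, s)) t) i"
    and "e i t \<omega> = snd (cser n H \<eta> C1 C2 f x0 (\<lambda>j s. history A \<omega> (j, s)) t) i"
proof -
  have "z j s \<omega> = history A \<omega> (j, s)" if "j \<in> {1..n}" "s \<in> {1..t}" for j s
  proof -
    have "(j, s) \<in> A" using assms(1) that by blast
    then show ?thesis by (simp add: history_def)
  qed
  note * = cser_cong[of n t "\<lambda>j s. z j s \<omega>" "\<lambda>j s. history A \<omega> (j, s)", OF this assms(2)]
  show "x i t \<omega> = fst (cser n H \<eta> C1 C2 f x0 (\<lambda>j s. history A \<omega> (j, s)) t) i"
    and "e i t \<omega> = snd (cser n H \<eta> C1 C2 f x0 (\<lambda>j s. history A \<omega> (j, s)) t) i"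
    unfolding x_def e_def by (use * in blast)+
qed

text \<open>Measurability with respect to the sigma-algebra of the history, in the factored form of
  Doob and Dynkin: the factor \<open>\<phi>\<close> is what the Fubini argument integrates.\<close>

definition past_measurable :: "(nat \<times> nat) set \<Rightarrow> ('w \<Rightarrow> 'v) \<Rightarrow> bool" where
  "past_measurable A Y \<longleftrightarrow> (\<exists>\<phi> \<in> borel_measurable (Pi\<^sub>M A (\<lambda>_. Z)). Y = (\<lambda>\<omega>. \<phi> (history A \<omega>)))"

lemma past_measurable_x:
  assumes "{1..n} \<times> {1..t} \<subseteq> A" "i \<in> {1..n}"
  shows "past_measurable A (x i t)"
  unfolding past_measurable_def
  using measurable_cser(1)[OF C1(3) C2(2) stoch_grad_measurable assms] state_history(1)[OF assms]
  by (intro bexI[rotated]) auto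

lemma past_measurable_compose:
  assumes "past_measurable A Y" "g \<in> borel_measurable borel"
  shows "past_measurable A (\<lambda>\<omega>. g (Y \<omega>))"
proof -
  obtain \<phi> where \<phi>: "\<phi> \<in> borel_measurable (Pi\<^sub>M A (\<lambda>_. Z))" "Y = (\<lambda>\<omega>. \<phi> (history A \<omega>))"
    using assms(1) unfolding past_measurable_def by blast
  show ?thesis
    unfolding past_measurable_def
    by (rule bexI[where x = "\<lambda>h. g (\<phi> h)"]) (use \<phi> assms(2) in auto)
qed

lemma past_measurable_diff:
  assumes "past_measurable A X" "past_measurable A Y"
  shows "past_measurable A (\<lambda>\<omega>. X \<omega> - Y \<omega>)"
proof -
  obtain \<phi> \<psi> where "\<phi> \<in> borel_measurable (Pi\<^sub>M A (\<lambda>_. Z))" "X = (\<lambda>\<omega>. \<phi> (history A \<omega>))"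
    "\<psi> \<in> borel_measurable (Pi\<^sub>M A (\<lambda>_. Z))" "Y = (\<lambda>\<omega>. \<psi> (history A \<omega>))"
    using assms unfolding past_measurable_def by blast
  then show ?thesis
    unfolding past_measurable_def by (intro bexI[where x = "\<lambda>h. \<phi> h - \<psi> h"]) auto
qed

lemma past_measurable_avg:
  assumes "\<And>i. i \<in> {1..n} \<Longrightarrow> past_measurable A (Y i)"
  shows "past_measurable A (\<lambda>\<omega>. avg n (\<lambda>i. Y i \<omega>))"
proof -
  obtain \<phi> where \<phi>: "\<And>i. i \<in> {1..n} \<Longrightarrow> \<phi> i \<in> borel_measurable (Pi\<^sub>M A (\<lambda>_. Z))"
    "\<And>i. i \<in> {1..n} \<Longrightarrow> Y i = (\<lambda>\<omega>. \<phi> i (history A \<omega>))"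
    using assms unfolding past_measurable_def by metis
  have "(\<lambda>h. avg n (\<lambda>i. \<phi> i h)) \<in> borel_measurable (Pi\<^sub>M A (\<lambda>_. Z))"
    by (rule borel_measurable_avg) (rule \<phi>)
  moreover have "(\<lambda>\<omega>. avg n (\<lambda>i. Y i \<omega>)) = (\<lambda>\<omega>. avg n (\<lambda>i. \<phi> i (history A \<omega>)))"
    using \<phi>(2) by (intro ext avg_cong) auto
  ultimately show ?thesis
    unfolding past_measurable_def by (intro bexI[where x = "\<lambda>h. avg n (\<lambda>i. \<phi> i h)"])
qed

lemma past_measurable_measurable:
  assumes "past_measurable A Y" "A \<subseteq> {1..n} \<times> {1..T}"
  shows "Y \<in> borel_measurable M"
  using assms(1) measurable_compose[OF history_measurable[OF assms(2)]]
  unfolding past_measurable_def by auto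

lemma past_measurable_mean:
  assumes "{1..n} \<times> {1..t} \<subseteq> A" "i \<in> {1..n}"
  shows "past_measurable A (mean i t)"
  unfolding mean_def
  using past_measurable_compose[OF past_measurable_x[OF assms] gradient_loss_measurable[OF assms(2)]] .

lemma past_measurable_sg:
  assumes "{1..n} \<times> {1..t} \<subseteq> A" "(i, Suc t) \<in> A" "i \<in> {1..n}"
  shows "past_measurable A (sg i t)"
proof -
  obtain \<phi> where \<phi>: "\<phi> \<in> borel_measurable (Pi\<^sub>M A (\<lambda>_. Z))" "x i t = (\<lambda>\<omega>. \<phi> (history A \<omega>))"
    using past_measurable_x[OF assms(1,3)] unfolding past_measurable_def by blast
  have "(\<lambda>h. (\<phi> h, h (i, Suc t))) \<in> measurable (Pi\<^sub>M A (\<lambda>_. Z)) (borel \<Otimes>\<^sub>M Z)"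
    using \<phi>(1) measurable_component_singleton[OF assms(2)] by (intro measurable_Pair)
  from measurable_compose[OF this stoch_grad_measurable]
  have "(\<lambda>h. stoch_grad f (\<phi> h) (h (i, Suc t))) \<in> borel_measurable (Pi\<^sub>M A (\<lambda>_. Z))" by simp
  moreover have "sg i t = (\<lambda>\<omega>. stoch_grad f (\<phi> (history A \<omega>)) (history A \<omega> (i, Suc t)))"
    using assms(2) \<phi>(2) by (auto simp: sg_def history_def fun_eq_iff)
  ultimately show ?thesis
    unfolding past_measurable_def
    by (intro bexI[where x = "\<lambda>h. stoch_grad f (\<phi> h) (h (i, Suc t))"])
qed

lemma past_measurable_noise:
  assumes "{1..n} \<times> {1..t} \<subseteq> A" "(i, Suc t) \<in> A" "i \<in> {1..n}"
  shows "past_measurable A (noise i t)"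
  unfolding noise_def
  by (intro past_measurable_diff past_measurable_sg past_measurable_mean assms)

text \<open>Given all samples except \<open>z i (t + 1)\<close>, the noise of worker \<open>i\<close> has mean zero; by Fubini it
  is orthogonal to every function of the other samples.\<close>

lemma noise_orthogonal:
  assumes A: "{1..n} \<times> {1..t} \<subseteq> A" "A \<subseteq> {1..n} \<times> {1..T}" "(i, Suc t) \<notin> A"
    and i: "i \<in> {1..n}" and t: "t < T"
    and Y: "past_measurable A Y" and int: "integrable M (\<lambda>\<omega>. noise i t \<omega> \<bullet> Y \<omega>)"
  shows "expectation (\<lambda>\<omega>. noise i t \<omega> \<bullet> Y \<omega>) = 0"
proof -
  let ?p = "(i, Suc t)"
  let ?P = "\<lambda>B. Pi\<^sub>M B (\<lambda>_::nat \<times> nat. Z)"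
  let ?grad = "gradient (local_loss f (D i))"
  have p: "?p \<in> {1..n} \<times> {1..T}" using i t by auto
  obtain \<phi> where \<phi>: "\<phi> \<in> borel_measurable (?P A)" "x i t = (\<lambda>\<omega>. \<phi> (history A \<omega>))"
    using past_measurable_x[OF A(1) i] unfolding past_measurable_def by blast
  obtain \<psi> where \<psi>: "\<psi> \<in> borel_measurable (?P A)" "Y = (\<lambda>\<omega>. \<psi> (history A \<omega>))"
    using Y unfolding past_measurable_def by blast
  define h where "h = (\<lambda>(u, w). (stoch_grad f (\<phi> u) (w ?p) - ?grad (\<phi> u)) \<bullet> \<psi> u)"
  have h_eq: "noise i t \<omega> \<bullet> Y \<omega> = h (history A \<omega>, history {?p} \<omega>)" for \<omega>
    by (simp add: h_def noise_def sg_def mean_def \<phi>(2) \<psi>(2)) (simp add: history_def)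
  have indep: "indep_var (?P A) (history A) (?P {?p}) (history {?p})"
    using indep_var_restrict[OF z_indep, of A "{?p}"] A p
    by (simp add: history_def[abs_def] case_prod_beta')
  have h_measurable: "h \<in> borel_measurable (?P A \<Otimes>\<^sub>M ?P {?p})"
  proof -
    have 1: "(\<lambda>q. \<phi> (fst q)) \<in> borel_measurable (?P A \<Otimes>\<^sub>M ?P {?p})"
      and 2: "(\<lambda>q. \<psi> (fst q)) \<in> borel_measurable (?P A \<Otimes>\<^sub>M ?P {?p})"
      using \<phi>(1) \<psi>(1) by measurable
    have "(\<lambda>q. (\<phi> (fst q), snd q ?p)) \<in> measurable (?P A \<Otimes>\<^sub>M ?P {?p}) (borel \<Otimes>\<^sub>M Z)"
      by (intro measurable_Pair 1 measurable_compose[OF measurable_snd measurable_component_singleton])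
        simp
    from measurable_compose[OF this stoch_grad_measurable]
      measurable_compose[OF 1 gradient_loss_measurable[OF i]] 2
    show ?thesis unfolding h_def case_prod_beta'
      by (intro borel_measurable_inner borel_measurable_diff) simp_all
  qed
  have "(\<integral>w. h (u, w) \<partial>distr M (?P {?p}) (history {?p})) = 0" for u
  proof -
    have D: "distr M Z (z i (Suc t)) = D i" using z_distr[of i "Suc t"] p by auto
    have z: "z i (Suc t) \<in> measurable M Z" using z_measurable[of i "Suc t"] p by auto
    have "sets (D i) = sets Z" by (simp flip: D)
    then have D_sets: "measurable (D i) N = measurable Z N" for N :: "'v measure"
      by (rule measurable_cong_sets) simp
    interpret Di: prob_space "D i" unfolding D[symmetric] by (rule prob_space_distr[OF z])
    let ?k = "\<lambda>\<zeta>. (stoch_grad f (\<phi> u) \<zeta> - ?grad (\<phi> u)) \<bullet> \<psi> u"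
    have k: "?k \<in> borel_measurable Z"
      using borel_measurable_integrable[OF sg_integrable[OF i, of "\<phi> u"]] unfolding D_sets
      by (intro borel_measurable_inner borel_measurable_diff) auto
    have "(\<integral>w. h (u, w) \<partial>distr M (?P {?p}) (history {?p})) = (\<integral>\<omega>. h (u, history {?p} \<omega>) \<partial>M)"
    proof (rule integral_distr)
      show "history {?p} \<in> measurable M (?P {?p})" by (rule history_measurable) (use p in auto)
      have "(\<lambda>w. w ?p) \<in> measurable (?P {?p}) Z" by (rule measurable_component_singleton) simp
      from measurable_compose[OF this k] show "(\<lambda>w. h (u, w)) \<in> borel_measurable (?P {?p})"
        by (simp add: h_def)
    qed
    also have "\<dots> = (\<integral>\<omega>. ?k (z i (Suc t) \<omega>) \<partial>M)" by (simp add: h_def history_def)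
    also have "\<dots> = (\<integral>\<zeta>. ?k \<zeta> \<partial>D i)" using integral_distr[OF z k] by (simp only: D)
    \<comment> \<open>With \<open>u\<close> frozen, \<open>\<phi> u\<close> and
      \<open>\<psi> u\<close> are constants, so unbiasedness at one deterministic point is
      enough.\<close>
    also have "\<dots> = ((\<integral>\<zeta>. stoch_grad f (\<phi> u) \<zeta> \<partial>D i) - ?grad (\<phi> u)) \<bullet> \<psi> u"
      using sg_integrable[OF i, of "\<phi> u"]
      by (simp add: Di.prob_space)
    also have "\<dots> = 0" by (simp add: sg_unbiased[OF i])
    finally show ?thesis .
  qed
  then have "expectation (\<lambda>\<omega>. h (history A \<omega>, history {?p} \<omega>)) = 0"
    using int unfolding h_eq by (intro expectation_indep_eq_0[OF indep h_measurable])
  then show ?thesis unfolding h_eq .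
qed

end

text \<open>Split off from \<open>cser_process\<close> because these assumptions speak of
  \<open>noise\<close> and \<open>mean\<close>, which exist only once the process is defined. The
  bound on \<open>mean\<close> is almost sure, as it concerns a mean given the past; the noise is
  bounded only in total expectation.\<close>

locale cser_bounded = cser_process M n H T f Z D z C1 C2 x0 \<eta> L \<delta>1 \<delta>2
  for M :: "'w measure" and n H T and f :: "'v::euclidean_space \<Rightarrow> 'z \<Rightarrow> real"
    and Z D z C1 C2 x0 \<eta> L \<delta>1 \<delta>2 +
  fixes V1 V1' :: real
  assumes noise_integrable: "\<And>i t. i \<in> {1..n} \<Longrightarrow> t < T \<Longrightarrow>
      integrable M (\<lambda>\<omega>. (norm (noise i t \<omega>))\<^sup>2)"
    and noise_bound: "\<And>i t. i \<in> {1..n} \<Longrightarrow> t < T \<Longrightarrow>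
      expectation (\<lambda>\<omega>. (norm (noise i t \<omega>))\<^sup>2) \<le> V1"
    and mean_bound: "\<And>i t. i \<in> {1..n} \<Longrightarrow> t < T \<Longrightarrow>
      AE \<omega> in M. (norm (mean i t \<omega>))\<^sup>2 \<le> V1'"
begin

lemma V1_nonneg: "0 \<le> V1"
proof -
  have "0 \<le> expectation (\<lambda>\<omega>. (norm (noise 1 0 \<omega>))\<^sup>2)" by simp
  also have "\<dots> \<le> V1" using n T by (intro noise_bound) auto
  finally show ?thesis .
qed

lemma V1'_nonneg: "0 \<le> V1'"
proof -
  have "AE \<omega> in M. (norm (mean 1 0 \<omega>))\<^sup>2 \<le> V1'" using n T by (intro mean_bound) auto
  then have "AE \<omega> in M. 0 \<le> V1'" by eventually_elim (meson order_trans zero_le_power2)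
  then show ?thesis by simp
qed

section \<open>Orthogonality and second moments of the gradient noise\<close>

lemma past_subset: "t \<le> T \<Longrightarrow> {1..n} \<times> {1..t} \<subseteq> {1..n} \<times> {1..T}"
  by auto

lemma sq_integrable_noise:
  assumes "i \<in> {1..n}" "t < T"
  shows "sq_integrable M (noise i t)"
proof -
  have "past_measurable ({1..n} \<times> {1..Suc t}) (noise i t)"
    using assms by (intro past_measurable_noise) auto
  then have "noise i t \<in> borel_measurable M"
    by (rule past_measurable_measurable[OF _ past_subset]) (use assms in simp)
  then show ?thesis using noise_integrable[OF assms] by (simp add: sq_integrable_def)
qed

lemma mean_measurable:
  assumes "i \<in> {1..n}" "t < T"
  shows "mean i t \<in> borel_measurable M"
proof -
  have "past_measurable ({1..n} \<times> {1..t}) (mean i t)"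
    using assms by (intro past_measurable_mean) auto
  then show ?thesis
    by (rule past_measurable_measurable[OF _ past_subset]) (use assms in simp)
qed

lemma sq_integrable_mean:
  assumes "i \<in> {1..n}" "t < T"
  shows "sq_integrable M (mean i t)"
  unfolding sq_integrable_def
proof
  note [measurable] = mean_measurable[OF assms]
  show "mean i t \<in> borel_measurable M" by measurable
  show "integrable M (\<lambda>\<omega>. (norm (mean i t \<omega>))\<^sup>2)"
    using mean_bound[OF assms] by (intro integrable_const_bound[where B = V1']) auto
qed

lemma noise_orthogonal_past:
  assumes "past_measurable ({1..n} \<times> {1..t}) Y" "sq_integrable M Y" "i \<in> {1..n}" "t < T"
  shows "expectation (\<lambda>\<omega>. noise i t \<omega> \<bullet> Y \<omega>) = 0"
  using assms
  by (intro noise_orthogonal[where A = "{1..n} \<times> {1..t}"] integrable_inner_sq_integrable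
      sq_integrable_noise) auto

text \<open>The two noises share the past and are not independent. Keeping every sample up to time
  \<open>t + 1\<close> except that of worker \<open>i\<close> makes the noise of \<open>j\<close> a
  function of the retained history.\<close>

lemma noise_orthogonal_noise:
  assumes "i \<in> {1..n}" "j \<in> {1..n}" "i \<noteq> j" "t < T"
  shows "expectation (\<lambda>\<omega>. noise i t \<omega> \<bullet> noise j t \<omega>) = 0"
  using assms
  by (intro noise_orthogonal[where A = "{1..n} \<times> {1..Suc t} - {(i, Suc t)}"]
      integrable_inner_sq_integrable sq_integrable_noise past_measurable_noise) auto

lemma sg_eq: "sg i t \<omega> = noise i t \<omega> + mean i t \<omega>"
  by (simp add: noise_def)

lemma sq_integrable_sg:
  assumes "i \<in> {1..n}" "t < T"
  shows "sq_integrable M (sg i t)"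
  using sq_integrable_add[OF sq_integrable_noise[OF assms] sq_integrable_mean[OF assms]]
  by (simp flip: sg_eq)

text \<open>Pythagoras: the mean is a function of the past, hence orthogonal to the noise. This is
  the constant \<open>V2\<close>.\<close>

lemma sg_bound:
  assumes "i \<in> {1..n}" "t < T"
  shows "expectation (\<lambda>\<omega>. (norm (sg i t \<omega>))\<^sup>2) \<le> V1 + V1'"
proof -
  have "past_measurable ({1..n} \<times> {1..t}) (mean i t)"
    using assms by (intro past_measurable_mean) auto
  then have "expectation (\<lambda>\<omega>. noise i t \<omega> \<bullet> mean i t \<omega>) = 0"
    using assms by (intro noise_orthogonal_past sq_integrable_mean)
  moreover have "expectation (\<lambda>\<omega>. (norm (mean i t \<omega>))\<^sup>2) \<le> V1'"
    by (intro integral_le_const mean_bound sq_integrableD(2)[OF sq_integrable_mean] assms)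
  ultimately show ?thesis
    unfolding sg_eq integral_norm_add_squared[OF sq_integrable_noise[OF assms] sq_integrable_mean[OF assms]]
    using noise_bound[OF assms] by simp
qed

text \<open>Only \<open>n\<close> diagonal terms of the \<open>n\<^sup>2\<close> inner products
  survive, which is the source of the \<open>1 / n\<close> in the last term of the theorem.\<close>

lemma noise_avg_bound:
  assumes "t < T"
  shows "expectation (\<lambda>\<omega>. (norm (avg n (\<lambda>i. noise i t \<omega>)))\<^sup>2) \<le> V1 / real n"
proof -
  have "(norm (avg n (\<lambda>i. noise i t \<omega>)))\<^sup>2
      = (\<Sum>i = 1..n. \<Sum>j = 1..n. noise i t \<omega> \<bullet> noise j t \<omega>) / (real n)\<^sup>2" for \<omega>
  proof -
    have "(norm (avg n (\<lambda>i. noise i t \<omega>)))\<^sup>2 = (norm (\<Sum>i = 1..n. noise i t \<omega>))\<^sup>2 / (real n)\<^sup>2"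
      by (simp add: avg_def power_divide)
    also have "(norm (\<Sum>i = 1..n. noise i t \<omega>))\<^sup>2 = (\<Sum>i = 1..n. \<Sum>j = 1..n. noise i t \<omega> \<bullet> noise j t \<omega>)"
      by (simp only: power2_norm_eq_inner inner_sum_left, simp only: inner_sum_right)
    finally show ?thesis .
  qed
  then have "expectation (\<lambda>\<omega>. (norm (avg n (\<lambda>i. noise i t \<omega>)))\<^sup>2)
      = (\<Sum>i = 1..n. \<Sum>j = 1..n. expectation (\<lambda>\<omega>. noise i t \<omega> \<bullet> noise j t \<omega>)) / (real n)\<^sup>2"
    using assms
    by (simp add: integrable_inner_sq_integrable sq_integrable_noise
        del: One_nat_def atLeastAtMost_iff)
  also have "(\<Sum>i = 1..n. \<Sum>j = 1..n. expectation (\<lambda>\<omega>. noise i t \<omega> \<bullet> noise j t \<omega>))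
      = (\<Sum>i = 1..n. \<Sum>j = 1..n. if j = i then expectation (\<lambda>\<omega>. (norm (noise i t \<omega>))\<^sup>2) else 0)"
    using assms by (intro sum.cong refl) (auto simp: power2_norm_eq_inner noise_orthogonal_noise)
  also have "\<dots> = (\<Sum>i = 1..n. expectation (\<lambda>\<omega>. (norm (noise i t \<omega>))\<^sup>2))"
    by (intro sum.cong refl) simp
  also have "\<dots> \<le> real n * V1"
    using sum_bounded_above[of "{1..n}" "\<lambda>i. expectation (\<lambda>\<omega>. (norm (noise i t \<omega>))\<^sup>2)" V1]
      noise_bound assms by simp
  finally show ?thesis
    using n by (simp add: divide_right_mono power2_eq_square)
qed

section \<open>Uniform bound on the compression error\<close>

definition b :: real where "b = \<eta> * sqrt ((1 - \<delta>2) * (V1 + V1'))"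

lemma \<delta>1_le: "\<delta>1 \<le> 1" and \<delta>2_le: "\<delta>2 \<le> 1"
  using C1(1) C2(1) by (auto simp: approx_compressor_def)

lemma b_nonneg: "0 \<le> b"
  using \<eta> \<delta>2_le V1_nonneg V1'_nonneg by (simp add: b_def)

lemma b_squared: "b\<^sup>2 = \<eta>\<^sup>2 * ((1 - \<delta>2) * (V1 + V1'))"
  using \<delta>2_le V1_nonneg V1'_nonneg by (simp add: b_def power_mult_distrib)

lemma residual_bound:
  assumes "i \<in> {1..n}" "t < T"
  shows "sq_integrable M (\<lambda>\<omega>. (- \<eta>) *\<^sub>R (sg i t \<omega> - C2 (sg i t \<omega>)))"
    and "expectation (\<lambda>\<omega>. (norm ((- \<eta>) *\<^sub>R (sg i t \<omega> - C2 (sg i t \<omega>))))\<^sup>2) \<le> b\<^sup>2"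
proof -
  note [measurable] = sq_integrableD(1)[OF sq_integrable_sg[OF assms]] C2(2)
  have sq: "sq_integrable M (\<lambda>\<omega>. sg i t \<omega> - C2 (sg i t \<omega>))"
    using approx_compressor_residual[OF C2(1)]
    by (intro sq_integrable_bound[OF sq_integrable_sg[OF assms], where c = "1 - \<delta>2"]) measurable
  then show "sq_integrable M (\<lambda>\<omega>. (- \<eta>) *\<^sub>R (sg i t \<omega> - C2 (sg i t \<omega>)))"
    by (rule sq_integrable_scaleR)
  have "expectation (\<lambda>\<omega>. (norm (sg i t \<omega> - C2 (sg i t \<omega>)))\<^sup>2)
      \<le> expectation (\<lambda>\<omega>. (1 - \<delta>2) * (norm (sg i t \<omega>))\<^sup>2)"
    using sq_integrableD(2)[OF sq] sq_integrableD(2)[OF sq_integrable_sg[OF assms]]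
    by (intro integral_mono approx_compressor_residual[OF C2(1)]) auto
  also have "\<dots> \<le> (1 - \<delta>2) * (V1 + V1')"
    using sg_bound[OF assms] \<delta>2_le by (simp add: mult_left_mono)
  finally have "\<eta>\<^sup>2 * expectation (\<lambda>\<omega>. (norm (sg i t \<omega> - C2 (sg i t \<omega>)))\<^sup>2)
      \<le> \<eta>\<^sup>2 * ((1 - \<delta>2) * (V1 + V1'))"
    by (intro mult_left_mono) auto
  then show "expectation (\<lambda>\<omega>. (norm ((- \<eta>) *\<^sub>R (sg i t \<omega> - C2 (sg i t \<omega>))))\<^sup>2) \<le> b\<^sup>2"
    by (simp add: b_squared power_mult_distrib)
qed

text \<open>The residual is written as a summand with factor \<open>- \<eta>\<close>, so that
  \<open>L2_Minkowski\<close> applies directly.\<close>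

lemma e_Suc:
  "e i (Suc t) \<omega> = (let eh = e i t \<omega> + (- \<eta>) *\<^sub>R (sg i t \<omega> - C2 (sg i t \<omega>))
     in if H dvd Suc t then eh - C1 eh else eh)"
  unfolding e_def sg_def x_def Let_def cser_error_Suc by simp

text \<open>In \<open>L\<^sup>2\<close> norm each step adds at most \<open>b\<close> to the error and each reset contracts it by
  \<open>s = sqrt (1 - \<delta>1)\<close>; \<open>s * H * b / (1 - s)\<close> is the fixed point of \<open>a \<mapsto> s * (a + H * b)\<close>.\<close>

lemma error_bound_mod:
  defines "s \<equiv> sqrt (1 - \<delta>1)"
  assumes "i \<in> {1..n}" "t \<le> T"
  shows "sq_integrable M (e i t) \<and>
    expectation (\<lambda>\<omega>. (norm (e i t \<omega>))\<^sup>2) \<le> (s * (real H * b) / (1 - s) + real (t mod H) * b)\<^sup>2"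
  using \<open>t \<le> T\<close>
proof (induction t)
  case 0
  have "e i 0 = (\<lambda>\<omega>. 0)" by (simp add: e_def fun_eq_iff)
  then show ?case by (simp add: sq_integrable_def)
next
  case (Suc t)
  have s: "0 \<le> s" "s < 1" "s\<^sup>2 = 1 - \<delta>1" using C1(2) \<delta>1_le by (auto simp: s_def)
  define K where "K = s * (real H * b) / (1 - s)"
  have K: "0 \<le> K" using s b_nonneg by (simp add: K_def)
  define eh where "eh = (\<lambda>\<omega>. e i t \<omega> + (- \<eta>) *\<^sub>R (sg i t \<omega> - C2 (sg i t \<omega>)))"
  have IH: "sq_integrable M (e i t)"
    "expectation (\<lambda>\<omega>. (norm (e i t \<omega>))\<^sup>2) \<le> (K + real (t mod H) * b)\<^sup>2"
    using Suc by (auto simp: K_def)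
  have t: "t < T" using Suc.prems by simp
  have eh: "sq_integrable M eh"
    unfolding eh_def by (intro sq_integrable_add IH residual_bound assms t)
  have "expectation (\<lambda>\<omega>. (norm (eh \<omega>))\<^sup>2) \<le> (K + real (t mod H) * b + b)\<^sup>2"
    unfolding eh_def using K b_nonneg
    by (intro L2_Minkowski IH residual_bound assms t) auto
  then have eh_le: "expectation (\<lambda>\<omega>. (norm (eh \<omega>))\<^sup>2) \<le> (K + real (Suc (t mod H)) * b)\<^sup>2"
    by (simp add: algebra_simps)
  show ?case
  proof (cases "H dvd Suc t")
    case False
    then have "e i (Suc t) = eh" by (simp add: fun_eq_iff e_Suc eh_def)
    moreover have "Suc t mod H = Suc (t mod H)"
      using False by (auto simp: mod_Suc dvd_eq_mod_eq_0)
    ultimately show ?thesis using eh eh_le by (simp add: K_def)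
  next
    case True
    note [measurable] = sq_integrableD(1)[OF eh] C1(3)
    have e_eq: "e i (Suc t) = (\<lambda>\<omega>. eh \<omega> - C1 (eh \<omega>))"
      using True by (simp add: fun_eq_iff e_Suc eh_def Let_def)
    have sq: "sq_integrable M (\<lambda>\<omega>. eh \<omega> - C1 (eh \<omega>))"
      using approx_compressor_residual[OF C1(1)]
      by (intro sq_integrable_bound[OF eh, where c = "1 - \<delta>1"]) measurable
    \<comment> \<open>The counter of steps since the last reset stood at \<open>H - 1\<close>, so
      now \<open>H\<close> increments have accumulated; after the reset it is 0.\<close>
    have "Suc (t mod H) = H"
      using True H by (auto simp: mod_Suc dvd_eq_mod_eq_0 split: if_splits)
    then have "expectation (\<lambda>\<omega>. (norm (eh \<omega>))\<^sup>2) \<le> (K + real H * b)\<^sup>2"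
      using eh_le by simp
    have "expectation (\<lambda>\<omega>. (norm (eh \<omega> - C1 (eh \<omega>)))\<^sup>2)
        \<le> expectation (\<lambda>\<omega>. s\<^sup>2 * (norm (eh \<omega>))\<^sup>2)"
      unfolding s(3) using sq_integrableD(2)[OF sq] sq_integrableD(2)[OF eh]
      by (intro integral_mono approx_compressor_residual[OF C1(1)]) auto
    also have "\<dots> \<le> s\<^sup>2 * (K + real H * b)\<^sup>2"
      using \<open>_ \<le> (K + real H * b)\<^sup>2\<close> by (simp add: mult_left_mono)
    also have "\<dots> = (s * (K + real H * b))\<^sup>2" by (simp add: power_mult_distrib)
    also have "s * (K + real H * b) = K"
      using s by (simp add: K_def field_simps)
    finally show ?thesis using True sq by (simp add: e_eq K_def dvd_eq_mod_eq_0)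
  qed
qed

text \<open>With \<open>K\<close> the fixed point from \<open>error_bound_mod\<close>, this is
  \<open>2 * K\<^sup>2 + 2 * (H * b)\<^sup>2\<close>, a bound for
  \<open>(K + H * b)\<^sup>2\<close>: hence the factor 2 and the summand 1. The counter
  \<open>t mod H\<close> is relaxed to \<open>H\<close>.\<close>

definition B :: real where
  "B = ((1 - \<delta>1) / (1 - sqrt (1 - \<delta>1))\<^sup>2 + 1) * (2 * (1 - \<delta>2) * \<eta>\<^sup>2 * (real H)\<^sup>2 * (V1 + V1'))"

lemma sq_integrable_e: "i \<in> {1..n} \<Longrightarrow> t \<le> T \<Longrightarrow> sq_integrable M (e i t)"
  using error_bound_mod by blast

lemma error_bound:
  assumes "i \<in> {1..n}" "t \<le> T"
  shows "expectation (\<lambda>\<omega>. (norm (e i t \<omega>))\<^sup>2) \<le> B"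
proof -
  define s where "s = sqrt (1 - \<delta>1)"
  have s: "0 \<le> s" "s < 1" "s\<^sup>2 = 1 - \<delta>1" using C1(2) \<delta>1_le by (auto simp: s_def)
  define K where "K = s * (real H * b) / (1 - s)"
  have K: "0 \<le> K" using s b_nonneg by (simp add: K_def)
  have "real (t mod H) * b \<le> real H * b"
    using H b_nonneg by (intro mult_right_mono) (auto intro: less_imp_le)
  then have "(K + real (t mod H) * b)\<^sup>2 \<le> (K + real H * b)\<^sup>2"
    using K b_nonneg by (intro power_mono) auto
  also have "\<dots> \<le> 2 * K\<^sup>2 + 2 * (real H * b)\<^sup>2"
    using zero_le_power2[of "K - real H * b"] by (simp add: power2_eq_square algebra_simps)
  also have "K\<^sup>2 = (1 - \<delta>1) / (1 - s)\<^sup>2 * (real H * b)\<^sup>2"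
    by (simp add: K_def power_divide power_mult_distrib s(3))
  also have "2 * ((1 - \<delta>1) / (1 - s)\<^sup>2 * (real H * b)\<^sup>2) + 2 * (real H * b)\<^sup>2
      = ((1 - \<delta>1) / (1 - s)\<^sup>2 + 1) * (2 * (real H * b)\<^sup>2)"
    by (simp add: distrib_right)
  also have "\<dots> = B"
    by (simp add: B_def s_def power_mult_distrib b_squared)
  finally show ?thesis
    using error_bound_mod[OF assms] by (simp add: K_def s_def)
qed

section \<open>The averaged objective and integrability along \<open>xbar\<close>\<close>

definition F :: "'v \<Rightarrow> real" where
  "F y = avg n (\<lambda>i. local_loss f (D i) y)"

lemma L_smooth_F: "L_smooth L F"
  unfolding F_def[abs_def] using n smooth by (intro L_smooth_avg)

lemma gradient_F: "gradient F = grad_F"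
  unfolding F_def[abs_def] grad_F_def[abs_def] using n smooth by (intro ext gradient_avg)

lemma grad_F_Lipschitz: "norm (grad_F y - grad_F y') \<le> L * norm (y - y')"
  using L_smooth_gradient_Lipschitz[OF L_smooth_F L_pos] unfolding gradient_F .

lemma F_bound: "\<bar>F y - F y' - grad_F y' \<bullet> (y - y')\<bar> \<le> L / 2 * (norm (y - y'))\<^sup>2"
  using L_smooth_bound[OF L_smooth_F] unfolding gradient_F .

lemma grad_F_measurable: "grad_F \<in> borel_measurable borel"
proof -
  have "L-lipschitz_on UNIV grad_F"
    using grad_F_Lipschitz L_pos by (intro lipschitz_onI) (auto simp: dist_norm)
  then show ?thesis by (intro borel_measurable_continuous_onI lipschitz_on_continuous_on)
qed

lemma F_measurable: "F \<in> borel_measurable borel"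
proof (intro borel_measurable_continuous_onI continuous_at_imp_continuous_on ballI)
  fix y show "isCont F y"
    using L_smooth_F by (intro differentiable_imp_continuous_within) (simp add: L_smooth_def)
qed

lemma xbar_0: "xbar 0 \<omega> = x0"
  using avg_const[OF n] by (simp add: xbar_def x_def)

lemma xbar_Suc: "xbar (Suc t) \<omega> = xbar t \<omega> - \<eta> *\<^sub>R avg n (\<lambda>i. sg i t \<omega>)"
  unfolding xbar_def x_def sg_def by (rule avg_cser_Suc[OF n])

lemma sq_integrable_xbar: "t \<le> T \<Longrightarrow> sq_integrable M (xbar t)"
proof (induction t)
  case 0
  have "xbar 0 = (\<lambda>\<omega>. x0)" by (simp add: fun_eq_iff xbar_0)
  then show ?case using sq_integrable_const[OF finite_measure_axioms] by simp
next
  case (Suc t)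
  then have "sq_integrable M (\<lambda>\<omega>. xbar t \<omega> - \<eta> *\<^sub>R avg n (\<lambda>i. sg i t \<omega>))"
    by (intro sq_integrable_diff sq_integrable_scaleR sq_integrable_avg sq_integrable_sg) auto
  then show ?case by (simp flip: xbar_Suc)
qed

lemma sq_integrable_xbar_diff: "t \<le> T \<Longrightarrow> sq_integrable M (\<lambda>\<omega>. xbar t \<omega> - c)"
  by (intro sq_integrable_diff sq_integrable_xbar sq_integrable_const finite_measure_axioms)

text \<open>A Lipschitz gradient grows at most linearly, so it inherits square integrability from
  \<open>xbar\<close>.\<close>

lemma sq_integrable_grad_F:
  assumes "t \<le> T"
  shows "sq_integrable M (\<lambda>\<omega>. grad_F (xbar t \<omega>))"
proof -
  note [measurable] = sq_integrableD(1)[OF sq_integrable_xbar[OF assms]] grad_F_measurable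
  have "sq_integrable M (\<lambda>\<omega>. grad_F (xbar t \<omega>) - grad_F 0)"
  proof (rule sq_integrable_bound[OF sq_integrable_xbar_diff[OF assms], where c = "L\<^sup>2"])
    show "(norm (grad_F (xbar t \<omega>) - grad_F 0))\<^sup>2 \<le> L\<^sup>2 * (norm (xbar t \<omega> - 0))\<^sup>2" for \<omega>
      using power_mono[OF grad_F_Lipschitz norm_ge_zero] by (simp only: power_mult_distrib)
  qed measurable
  from sq_integrable_add[OF this sq_integrable_const[OF finite_measure_axioms, of "grad_F 0"]]
  show ?thesis by simp
qed

text \<open>After the affine part at \<open>x0\<close> is subtracted, smoothness dominates
  \<open>F\<close> by the squared distance from \<open>x0\<close>, so square integrability of
  \<open>xbar\<close> suffices.\<close>

lemma integrable_F:
  assumes "t \<le> T"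
  shows "integrable M (\<lambda>\<omega>. F (xbar t \<omega>))"
proof -
  note [measurable] = sq_integrableD(1)[OF sq_integrable_xbar[OF assms]] F_measurable
  note sq = sq_integrable_xbar_diff[OF assms, of x0]
  let ?l = "\<lambda>\<omega>. grad_F x0 \<bullet> (xbar t \<omega> - x0)"
  have l: "integrable M ?l"
    by (intro integrable_inner_sq_integrable sq sq_integrable_const finite_measure_axioms)
  have "integrable M (\<lambda>\<omega>. L / 2 * (norm (xbar t \<omega> - x0))\<^sup>2)"
    using sq_integrableD(2)[OF sq] by simp
  then have "integrable M (\<lambda>\<omega>. F (xbar t \<omega>) - F x0 - ?l \<omega>)"
  proof (rule Bochner_Integration.integrable_bound)
    show "AE \<omega> in M. norm (F (xbar t \<omega>) - F x0 - ?l \<omega>) \<le> norm (L / 2 * (norm (xbar t \<omega> - x0))\<^sup>2)"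
      unfolding real_norm_def by (intro AE_I2 order_trans[OF F_bound abs_ge_self])
  qed measurable
  from Bochner_Integration.integrable_add[OF this l]
  have "integrable M (\<lambda>\<omega>. F (xbar t \<omega>) - F x0)" by simp
  from Bochner_Integration.integrable_add[OF this, of "\<lambda>_. F x0"] show ?thesis by simp
qed

section \<open>Descent along the averaged iterate\<close>

lemma gradient_deviation:
  "(norm (grad_F (xbar t \<omega>) - avg n (\<lambda>i. mean i t \<omega>)))\<^sup>2 \<le> L\<^sup>2 * avg n (\<lambda>i. (norm (e i t \<omega>))\<^sup>2)"
proof -
  let ?G = "\<lambda>i. gradient (local_loss f (D i))"
  \<comment> \<open>The bias of the averaged step: each worker evaluates its gradient at
    \<open>x i t\<close> rather than at \<open>xbar t\<close>. Jensen, the Lipschitz bound and the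
    consensus bound follow.\<close>
  have "grad_F (xbar t \<omega>) - avg n (\<lambda>i. mean i t \<omega>) = avg n (\<lambda>i. ?G i (xbar t \<omega>) - ?G i (x i t \<omega>))"
    by (simp add: grad_F_def mean_def avg_diff)
  then have "(norm (grad_F (xbar t \<omega>) - avg n (\<lambda>i. mean i t \<omega>)))\<^sup>2
      \<le> avg n (\<lambda>i. (norm (?G i (xbar t \<omega>) - ?G i (x i t \<omega>)))\<^sup>2)"
    by (simp add: norm_avg_squared_le[OF n])
  also have "\<dots> \<le> avg n (\<lambda>i. L\<^sup>2 * (norm (xbar t \<omega> - x i t \<omega>))\<^sup>2)"
    unfolding power_mult_distrib[symmetric]
    by (intro avg_mono power_mono L_smooth_gradient_Lipschitz smooth L_pos) auto
  also have "\<dots> = L\<^sup>2 * avg n (\<lambda>i. (norm (xbar t \<omega> - x i t \<omega>))\<^sup>2)"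
    using avg_scaleR[of n "L\<^sup>2" "\<lambda>i. (norm (xbar t \<omega> - x i t \<omega>))\<^sup>2"] by simp
  also have "\<dots> \<le> L\<^sup>2 * avg n (\<lambda>i. (norm (e i t \<omega>))\<^sup>2)"
    unfolding xbar_def x_def e_def by (intro mult_left_mono avg_norm_x_minus_avg_le n) auto
  finally show ?thesis .
qed

text \<open>Holds on every sample path, so the inner products with the noise are kept; they vanish
  only in expectation.\<close>

lemma descent:
  fixes t \<omega>
  defines "a \<equiv> grad_F (xbar t \<omega>)" and "m \<equiv> avg n (\<lambda>i. mean i t \<omega>)"
    and "\<nu> \<equiv> avg n (\<lambda>i. noise i t \<omega>)"
  shows "F (xbar (Suc t) \<omega>) \<le> F (xbar t \<omega>) - \<eta> / 2 * (norm a)\<^sup>2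
    + \<eta> / 2 * L\<^sup>2 * avg n (\<lambda>i. (norm (e i t \<omega>))\<^sup>2)
    - \<eta> * (\<nu> \<bullet> a) + L * \<eta>\<^sup>2 * (\<nu> \<bullet> m) + L / 2 * \<eta>\<^sup>2 * (norm \<nu>)\<^sup>2"
proof -
  have step: "xbar (Suc t) \<omega> - xbar t \<omega> = - \<eta> *\<^sub>R (\<nu> + m)"
    by (simp add: xbar_Suc sg_eq avg_add \<nu>_def m_def)
  have "F (xbar (Suc t) \<omega>) \<le> F (xbar t \<omega>) + a \<bullet> (xbar (Suc t) \<omega> - xbar t \<omega>)
      + L / 2 * (norm (xbar (Suc t) \<omega> - xbar t \<omega>))\<^sup>2"
    using F_bound[of "xbar (Suc t) \<omega>" "xbar t \<omega>"] unfolding a_def abs_le_iff by linarith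
  also have "\<dots> = F (xbar t \<omega>) - \<eta> * (\<nu> \<bullet> a) - \<eta> * (a \<bullet> m)
      + L / 2 * \<eta>\<^sup>2 * ((norm \<nu>)\<^sup>2 + 2 * (\<nu> \<bullet> m) + (norm m)\<^sup>2)"
    unfolding step
    by (simp add: power_mult_distrib power2_norm_eq_inner[of "\<nu> + m"] inner_add_left inner_add_right
        inner_commute power2_norm_eq_inner[of \<nu>] power2_norm_eq_inner[of m] distrib_left)
  \<comment> \<open>Polarization trades the inner product for the wanted
    \<open>(norm a)\<^sup>2\<close>, the bias \<open>norm (a - m)\<close>, and a negative multiple
    of \<open>(norm m)\<^sup>2\<close> in the bound.\<close>
  also have "\<eta> * (a \<bullet> m) = \<eta> / 2 * (norm a)\<^sup>2 + \<eta> / 2 * (norm m)\<^sup>2 - \<eta> / 2 * (norm (a - m))\<^sup>2"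
    by (simp add: power2_norm_eq_inner inner_commute algebra_simps)
  finally have 1: "F (xbar (Suc t) \<omega>) \<le> F (xbar t \<omega>) - \<eta> * (\<nu> \<bullet> a)
      - (\<eta> / 2 * (norm a)\<^sup>2 + \<eta> / 2 * (norm m)\<^sup>2 - \<eta> / 2 * (norm (a - m))\<^sup>2)
      + L / 2 * \<eta>\<^sup>2 * ((norm \<nu>)\<^sup>2 + 2 * (\<nu> \<bullet> m) + (norm m)\<^sup>2)" .
  have "\<eta> / 2 * (norm (a - m))\<^sup>2 \<le> \<eta> / 2 * (L\<^sup>2 * avg n (\<lambda>i. (norm (e i t \<omega>))\<^sup>2))"
    unfolding a_def m_def using \<eta>(1) by (intro mult_left_mono gradient_deviation) auto
  \<comment> \<open>Here \<open>L * \<eta> \<le> 1\<close> lets that negative term absorb the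
    second-order term in \<open>m\<close>.\<close>
  moreover have "L / 2 * \<eta>\<^sup>2 * (norm m)\<^sup>2 \<le> \<eta> / 2 * (norm m)\<^sup>2"
  proof (intro mult_right_mono)
    have "(L * \<eta>) * \<eta> \<le> 1 * \<eta>"
      using \<eta> L_pos by (intro mult_right_mono) (auto simp: field_simps)
    then show "L / 2 * \<eta>\<^sup>2 \<le> \<eta> / 2" by (simp add: power2_eq_square)
  qed simp
  ultimately show ?thesis using 1 by (simp add: distrib_left)
qed

lemma noise_avg_orthogonal:
  assumes "past_measurable ({1..n} \<times> {1..t}) Y" "sq_integrable M Y" "t < T"
  shows "expectation (\<lambda>\<omega>. avg n (\<lambda>i. noise i t \<omega>) \<bullet> Y \<omega>) = 0"
proof -
  have "avg n (\<lambda>i. noise i t \<omega>) \<bullet> Y \<omega> = (1 / real n) * (\<Sum>i = 1..n. noise i t \<omega> \<bullet> Y \<omega>)" for \<omega>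
    by (simp add: avg_def inner_sum_left)
  moreover have "expectation (\<lambda>\<omega>. \<Sum>i = 1..n. noise i t \<omega> \<bullet> Y \<omega>) = 0"
    using assms
    by (subst Bochner_Integration.integral_sum)
      (auto intro!: integrable_inner_sq_integrable sq_integrable_noise noise_orthogonal_past sum.neutral)
  ultimately show ?thesis by simp
qed

lemma expected_descent:
  assumes "t < T"
  shows "expectation (\<lambda>\<omega>. F (xbar (Suc t) \<omega>)) \<le> expectation (\<lambda>\<omega>. F (xbar t \<omega>))
    - \<eta> / 2 * expectation (\<lambda>\<omega>. (norm (grad_F (xbar t \<omega>)))\<^sup>2)
    + \<eta> / 2 * L\<^sup>2 * B + L / 2 * \<eta>\<^sup>2 * (V1 / real n)"
proof -
  let ?a = "\<lambda>\<omega>. grad_F (xbar t \<omega>)" and ?m = "\<lambda>\<omega>. avg n (\<lambda>i. mean i t \<omega>)"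
    and ?\<nu> = "\<lambda>\<omega>. avg n (\<lambda>i. noise i t \<omega>)" and ?E = "\<lambda>\<omega>. avg n (\<lambda>i. (norm (e i t \<omega>))\<^sup>2)"
  have t: "t \<le> T" "Suc t \<le> T" using assms by auto
  have a: "sq_integrable M ?a" using t by (intro sq_integrable_grad_F)
  have m: "sq_integrable M ?m" using assms by (intro sq_integrable_avg sq_integrable_mean)
  have \<nu>: "sq_integrable M ?\<nu>" using assms by (intro sq_integrable_avg sq_integrable_noise)
  have E: "integrable M ?E"
    unfolding avg_def using sq_integrableD(2)[OF sq_integrable_e[OF _ t(1)]]
    by (intro integrable_scaleR_right Bochner_Integration.integrable_sum)
  have "expectation ?E = avg n (\<lambda>i. expectation (\<lambda>\<omega>. (norm (e i t \<omega>))\<^sup>2))"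
    unfolding avg_def using sq_integrableD(2)[OF sq_integrable_e[OF _ t(1)]] by simp
  also have "\<dots> \<le> avg n (\<lambda>i. B)" using t(1) by (intro avg_mono error_bound)
  finally have E_le: "expectation ?E \<le> B" by (simp only: avg_const[OF n])
  \<comment> \<open>Both \<open>?a\<close> and \<open>?m\<close> are fixed by the samples of the
    first \<open>t\<close> iterations, whereas the noise belongs to iteration \<open>t + 1\<close>;
    hence both cross terms have expectation 0.\<close>
  have pa: "past_measurable ({1..n} \<times> {1..t}) ?a"
    unfolding xbar_def
    by (intro past_measurable_compose[OF _ grad_F_measurable] past_measurable_avg past_measurable_x) auto
  have pm: "past_measurable ({1..n} \<times> {1..t}) ?m"
    by (intro past_measurable_avg past_measurable_mean) auto
  note int = integrable_F[OF t(1)] sq_integrableD(2)[OF a] E sq_integrableD(2)[OF \<nu>]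
    integrable_inner_sq_integrable[OF \<nu> a] integrable_inner_sq_integrable[OF \<nu> m]
  have "expectation (\<lambda>\<omega>. F (xbar (Suc t) \<omega>)) \<le> expectation (\<lambda>\<omega>. F (xbar t \<omega>)
      - \<eta> / 2 * (norm (?a \<omega>))\<^sup>2 + \<eta> / 2 * L\<^sup>2 * ?E \<omega>
      - \<eta> * (?\<nu> \<omega> \<bullet> ?a \<omega>) + L * \<eta>\<^sup>2 * (?\<nu> \<omega> \<bullet> ?m \<omega>) + L / 2 * \<eta>\<^sup>2 * (norm (?\<nu> \<omega>))\<^sup>2)"
    using integrable_F[OF t(2)] int
    by (intro integral_mono descent Bochner_Integration.integrable_add Bochner_Integration.integrable_diff
        integrable_mult_right)
  also have "\<dots> = expectation (\<lambda>\<omega>. F (xbar t \<omega>))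
      - \<eta> / 2 * expectation (\<lambda>\<omega>. (norm (?a \<omega>))\<^sup>2) + \<eta> / 2 * L\<^sup>2 * expectation ?E
      - \<eta> * expectation (\<lambda>\<omega>. ?\<nu> \<omega> \<bullet> ?a \<omega>) + L * \<eta>\<^sup>2 * expectation (\<lambda>\<omega>. ?\<nu> \<omega> \<bullet> ?m \<omega>)
      + L / 2 * \<eta>\<^sup>2 * expectation (\<lambda>\<omega>. (norm (?\<nu> \<omega>))\<^sup>2)"
    using int by simp
  also have "\<dots> = expectation (\<lambda>\<omega>. F (xbar t \<omega>))
      - \<eta> / 2 * expectation (\<lambda>\<omega>. (norm (?a \<omega>))\<^sup>2) + \<eta> / 2 * L\<^sup>2 * expectation ?E
      + L / 2 * \<eta>\<^sup>2 * expectation (\<lambda>\<omega>. (norm (?\<nu> \<omega>))\<^sup>2)"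
    by (simp only: noise_avg_orthogonal[OF pa a assms] noise_avg_orthogonal[OF pm m assms])
  also have "\<dots> \<le> expectation (\<lambda>\<omega>. F (xbar t \<omega>))
      - \<eta> / 2 * expectation (\<lambda>\<omega>. (norm (?a \<omega>))\<^sup>2) + \<eta> / 2 * L\<^sup>2 * B + L / 2 * \<eta>\<^sup>2 * (V1 / real n)"
    using \<eta> L_pos by (intro add_mono mult_left_mono order_refl E_le noise_avg_bound assms) auto
  finally show ?thesis .
qed

lemma convergence:
  assumes "\<And>y. Fmin \<le> F y"
  shows "(1 / real T) * (\<Sum>t<T. expectation (\<lambda>\<omega>. (norm (grad_F (xbar t \<omega>)))\<^sup>2))
    \<le> 2 * (F x0 - Fmin) / (\<eta> * real T) + L\<^sup>2 * B + L * \<eta> * V1 / real n"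
proof -
  define G where "G = (\<lambda>t. expectation (\<lambda>\<omega>. (norm (grad_F (xbar t \<omega>)))\<^sup>2))"
  define c where "c = \<eta> / 2 * L\<^sup>2 * B + L / 2 * \<eta>\<^sup>2 * (V1 / real n)"
  \<comment> \<open>The expected value of \<open>F\<close> at time \<open>t\<close> must stay on the
    right for the induction to close; the lower bound \<open>Fmin\<close> enters only at
    \<open>T\<close>.\<close>
  have "\<eta> / 2 * (\<Sum>s<t. G s) \<le> F x0 - expectation (\<lambda>\<omega>. F (xbar t \<omega>)) + real t * c" if "t \<le> T" for t
    using that
  proof (induction t)
    case 0
    then show ?case by (simp add: xbar_0 prob_space)
  next
    case (Suc t)
    have "expectation (\<lambda>\<omega>. F (xbar (Suc t) \<omega>)) \<le> expectation (\<lambda>\<omega>. F (xbar t \<omega>)) - \<eta> / 2 * G t + c"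
      using expected_descent[of t] Suc.prems unfolding G_def c_def by linarith
    with Suc show ?case by (simp add: distrib_left distrib_right)
  qed
  from this[of T] have 1: "\<eta> / 2 * (\<Sum>s<T. G s) \<le> F x0 - expectation (\<lambda>\<omega>. F (xbar T \<omega>)) + real T * c"
    by simp
  have "Fmin \<le> expectation (\<lambda>\<omega>. F (xbar T \<omega>))"
    using assms by (intro integral_ge_const integrable_F) auto
  with 1 have "\<eta> / 2 * (\<Sum>s<T. G s) \<le> F x0 - Fmin + real T * c" by linarith
  then have "2 / (\<eta> * real T) * (\<eta> / 2 * (\<Sum>s<T. G s)) \<le> 2 / (\<eta> * real T) * (F x0 - Fmin + real T * c)"
    using \<eta> by (intro mult_left_mono) auto
  moreover have "2 / (\<eta> * real T) * (\<eta> / 2 * (\<Sum>s<T. G s)) = (1 / real T) * (\<Sum>s<T. G s)"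
    using \<eta> by simp
  moreover have "2 / (\<eta> * real T) * (F x0 - Fmin + real T * c)
      = 2 * (F x0 - Fmin) / (\<eta> * real T) + 2 / \<eta> * c"
    using T \<eta> by (simp add: distrib_left add_divide_distrib)
  moreover have "2 / \<eta> * c = L\<^sup>2 * B + L * \<eta> * V1 / real n"
    using \<eta> n by (simp add: c_def field_simps power2_eq_square)
  ultimately show ?thesis unfolding G_def by linarith
qed

end

text \<open>The tangent bound \<open>sqrt (1 - \<delta>) \<le> 1 - \<delta> / 2\<close> gives
  \<open>1 - sqrt (1 - \<delta>) \<ge> \<delta> / 2\<close>.\<close>

lemma compressor_constant_le:
  fixes \<delta> :: real
  assumes "0 < \<delta>" "\<delta> \<le> 1"
  shows "(1 - \<delta>) / (1 - sqrt (1 - \<delta>))\<^sup>2 \<le> 4 * (1 - \<delta>) / \<delta>\<^sup>2"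
proof -
  have "sqrt (1 - \<delta>) \<le> 1 - \<delta> / 2"
    using assms by (intro real_le_lsqrt) (auto simp: power2_eq_square algebra_simps)
  then have "(\<delta> / 2)\<^sup>2 \<le> (1 - sqrt (1 - \<delta>))\<^sup>2"
    using assms by (intro power_mono) auto
  then have "(1 - \<delta>) / (1 - sqrt (1 - \<delta>))\<^sup>2 \<le> (1 - \<delta>) / (\<delta> / 2)\<^sup>2"
    using assms by (intro divide_left_mono) (auto intro!: mult_pos_pos)
  then show ?thesis by (simp add: power_divide mult.commute)
qed

text \<open>Integrability is part of the conclusion because the integral of a non-integrable
  function is 0 by convention, and the averaged bound would then say nothing.\<close>

theorem theorem1:
  fixes n H T :: nat
    and f :: "real ^ 'd \<Rightarrow> 'z \<Rightarrow> real"
    and Z :: "'z measure" and D :: "nat \<Rightarrow> 'z measure"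
    and M :: "'w measure" and z :: "nat \<Rightarrow> nat \<Rightarrow> 'w \<Rightarrow> 'z"
    and C1 C2 :: "real ^ 'd \<Rightarrow> real ^ 'd"
    and x0 xstar :: "real ^ 'd"
    and x :: "nat \<Rightarrow> nat \<Rightarrow> 'w \<Rightarrow> real ^ 'd"
    and xbar :: "nat \<Rightarrow> 'w \<Rightarrow> real ^ 'd"
    and F :: "real ^ 'd \<Rightarrow> real" and Fi :: "nat \<Rightarrow> real ^ 'd \<Rightarrow> real"
    and \<eta> L \<delta>1 \<delta>2 V1 V1' V2 :: real
  assumes "n \<ge> 1" "T \<ge> 1" "H > 0"
    (* compressors *)
    and "approx_compressor \<delta>1 C1" "0 < \<delta>1" "\<delta>1 \<le> 1"
    and "approx_compressor \<delta>2 C2" "0 \<le> \<delta>2" "\<delta>2 \<le> 1"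
    and "C1 \<in> borel_measurable borel" "C2 \<in> borel_measurable borel"
    (* local data distributions and objective *)
    and "\<And>i. i \<in> {1..n} \<Longrightarrow> prob_space (D i)"
    and "\<And>i. i \<in> {1..n} \<Longrightarrow> sets (D i) = sets Z"
    and "inj_on D {1..n}"
    and "(\<lambda>(y, \<zeta>). f y \<zeta>) \<in> borel_measurable (borel \<Otimes>\<^sub>M Z)"
    and "\<And>i y. i \<in> {1..n} \<Longrightarrow> integrable (D i) (f y)"
    and "Fi = (\<lambda>i. local_loss f (D i))"
    and "F = global_loss n f D"
    (* f(.; z) has a gradient, and it is an unbiased estimate of the gradient of F_i *)
    and "\<And>y \<zeta>. \<zeta> \<in> space Z \<Longrightarrow> (\<lambda>y'. f y' \<zeta>) differentiable (at y)"
    and "\<And>i y. i \<in> {1..n} \<Longrightarrow> integrable (D i) (stoch_grad f y)"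
    and "\<And>i y. i \<in> {1..n} \<Longrightarrow> (\<integral>\<zeta>. stoch_grad f y \<zeta> \<partial>D i) = gradient (Fi i) y"
    (* sampling *)
    and "prob_space M"
    and "prob_space.indep_vars M (\<lambda>_. Z) (\<lambda>(i, t). z i t) ({1..n} \<times> {1..T})"
    and "\<And>i t. i \<in> {1..n} \<Longrightarrow> t \<in> {1..T} \<Longrightarrow> distr M Z (z i t) = D i"
    (* iterates of CSER *)
    and "x = (\<lambda>i t \<omega>. cser_x n H \<eta> C1 C2 f x0 (\<lambda>j s. z j s \<omega>) i t)"
    and "xbar = (\<lambda>t \<omega>. avg n (\<lambda>i. x i t \<omega>))"
    and "0 < \<eta>" "\<eta> \<le> 1 / L"
    (* smoothness *)
    and "\<And>i. i \<in> {1..n} \<Longrightarrow> L_smooth L (Fi i)"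
    (* stochastic gradients; the mean of g_{i,t} is taken over z_{i,t}, given x_{i,t-1} *)
    and "\<And>i t. i \<in> {1..n} \<Longrightarrow> t \<in> {1..T} \<Longrightarrow>
           integrable M (\<lambda>\<omega>. (norm (stoch_grad f (x i (t - 1) \<omega>) (z i t \<omega>)
                                     - gradient (Fi i) (x i (t - 1) \<omega>)))\<^sup>2)"
    and "\<And>i t. i \<in> {1..n} \<Longrightarrow> t \<in> {1..T} \<Longrightarrow>
           (\<integral>\<omega>. (norm (stoch_grad f (x i (t - 1) \<omega>) (z i t \<omega>)
                        - gradient (Fi i) (x i (t - 1) \<omega>)))\<^sup>2 \<partial>M) \<le> V1"
    and "\<And>i t. i \<in> {1..n} \<Longrightarrow> t \<in> {1..T} \<Longrightarrow>
           (AE \<omega> in M. (norm (\<integral>\<zeta>. stoch_grad f (x i (t - 1) \<omega>) \<zeta> \<partial>D i))\<^sup>2 \<le> V1')"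
    and "V2 = V1 + V1'"
    (* global minimum *)
    and "\<And>y. F xstar \<le> F y"
  shows "(\<forall>t \<in> {1..T}. integrable M (\<lambda>\<omega>. (norm (gradient F (xbar (t - 1) \<omega>)))\<^sup>2)) \<and>
    (1 / real T) * (\<Sum>t = 1..T. (\<integral>\<omega>. (norm (gradient F (xbar (t - 1) \<omega>)))\<^sup>2 \<partial>M))
      \<le> 2 * (F x0 - F xstar) / (\<eta> * real T)
        + ((1 - \<delta>1) / (1 - sqrt (1 - \<delta>1))\<^sup>2 + 1)
            * (2 * (1 - \<delta>2) * \<eta>\<^sup>2 * L\<^sup>2 * (real H)\<^sup>2 * V2)
        + L * \<eta> * V1 / real n \<and>
    2 * (F x0 - F xstar) / (\<eta> * real T)
        + ((1 - \<delta>1) / (1 - sqrt (1 - \<delta>1))\<^sup>2 + 1)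
            * (2 * (1 - \<delta>2) * \<eta>\<^sup>2 * L\<^sup>2 * (real H)\<^sup>2 * V2)
        + L * \<eta> * V1 / real n
      \<le> 2 * (F x0 - F xstar) / (\<eta> * real T)
        + (4 * (1 - \<delta>1) / \<delta>1\<^sup>2 + 1)
            * (2 * (1 - \<delta>2) * \<eta>\<^sup>2 * L\<^sup>2 * (real H)\<^sup>2 * V2)
        + L * \<eta> * V1 / real n"
proof (rule conjI[OF _ conjI])
  interpret cser_process M n H T f Z D z C1 C2 x0 \<eta> L \<delta>1 \<delta>2
    using assms unfolding cser_process_def cser_process_axioms_def by simp
  have x: "x = cser_process.x n H f z C1 C2 x0 \<eta>"
    unfolding assms(25) x_def cser_x_def ..
  interpret cser_bounded M n H T f Z D z C1 C2 x0 \<eta> L \<delta>1 \<delta>2 V1 V1'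
  proof
    \<comment> \<open>Index \<open>t\<close> of the locale is iteration \<open>Suc t\<close> of the
      statement, whose starting point has index \<open>Suc t - 1 = t\<close>.\<close>
    fix i t assume it: "i \<in> {1..n}" "t < T"
    then have t: "Suc t \<in> {1..T}" by simp
    note simps = noise_def sg_def mean_def x[symmetric] assms(17)
    show "integrable M (\<lambda>\<omega>. (norm (noise i t \<omega>))\<^sup>2)"
      using assms(30)[OF it(1) t] by (simp add: simps)
    show "expectation (\<lambda>\<omega>. (norm (noise i t \<omega>))\<^sup>2) \<le> V1"
      using assms(31)[OF it(1) t] by (simp add: simps)
    \<comment> \<open>The hypothesis bounds an integral over a fresh sample at the current point;
      unbiasedness identifies it with \<open>mean i t\<close>.\<close>
    show "AE \<omega> in M. (norm (mean i t \<omega>))\<^sup>2 \<le> V1'"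
      using assms(32)[OF it(1) t] assms(21)[OF it(1)] by (simp add: simps)
  qed
  have F: "F = local.F"
    by (simp add: fun_eq_iff assms(18) local.F_def global_loss_def avg_def)
  have xbar: "xbar = local.xbar"
    by (simp add: fun_eq_iff assms(26) local.xbar_def x)
  have grad: "gradient F = grad_F" using gradient_F by (simp add: F)
  show "\<forall>t \<in> {1..T}. integrable M (\<lambda>\<omega>. (norm (gradient F (xbar (t - 1) \<omega>)))\<^sup>2)"
    unfolding grad xbar
    by (intro ballI sq_integrableD(2)[OF sq_integrable_grad_F]) auto
  let ?K = "2 * (1 - \<delta>2) * \<eta>\<^sup>2 * L\<^sup>2 * (real H)\<^sup>2 * V2"
  have "(\<Sum>t = 1..T. (\<integral>\<omega>. (norm (gradient F (xbar (t - 1) \<omega>)))\<^sup>2 \<partial>M))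
      = (\<Sum>t<T. expectation (\<lambda>\<omega>. (norm (grad_F (local.xbar t \<omega>)))\<^sup>2))"
    unfolding grad xbar by (simp add: sum.atLeast1_atMost_eq)
  moreover have "L\<^sup>2 * B = ((1 - \<delta>1) / (1 - sqrt (1 - \<delta>1))\<^sup>2 + 1) * ?K"
    by (simp add: B_def assms(33) mult_ac)
  ultimately show "(1 / real T) * (\<Sum>t = 1..T. (\<integral>\<omega>. (norm (gradient F (xbar (t - 1) \<omega>)))\<^sup>2 \<partial>M))
      \<le> 2 * (F x0 - F xstar) / (\<eta> * real T)
        + ((1 - \<delta>1) / (1 - sqrt (1 - \<delta>1))\<^sup>2 + 1) * ?K + L * \<eta> * V1 / real n"
    using convergence[of "F xstar"] assms(34) by (simp only: F)
  have "0 \<le> ?K"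
    using \<delta>2_le V1_nonneg V1'_nonneg by (simp add: assms(33))
  then show "2 * (F x0 - F xstar) / (\<eta> * real T)
        + ((1 - \<delta>1) / (1 - sqrt (1 - \<delta>1))\<^sup>2 + 1) * ?K + L * \<eta> * V1 / real n
      \<le> 2 * (F x0 - F xstar) / (\<eta> * real T)
        + (4 * (1 - \<delta>1) / \<delta>1\<^sup>2 + 1) * ?K + L * \<eta> * V1 / real n"
    using compressor_constant_le[OF assms(5,6)] by (intro add_mono mult_right_mono order_refl)
qed

end
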